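(* Let $(\omega_1,\omega_2,\omega_3)$ be an $\boldsymbol\varepsilon$-hypersymplectic structure on a Lie algebroid $(A,\rho,[\cdot,\cdot])$, with inverse Poisson bivectors $\pi_1,\pi_2,\pi_3$ and transition tensors $N_1,N_2,N_3$. For all $i,k\in\{1,2,3\}$ with $i\neq k$: (a) $(\pi_i,N_k)$ is a Poisson–Nijenhuis ($PN$) structure on $A$; (b) $(\omega_i,N_k)$ is an $\Omega N$ structure on $A$.
   Context: Let $\mathrm d$ denote the differential of the Lie algebroid. For a $2$-form $\omega\in\Gamma(\bigwedge^2A^* )$, $\langle\omega^\flat(X),Y\rangle=\omega(X,Y)$; for a bivector $\pi\in\Gamma(\bigwedge^2A)$, $\langle\beta,\pi^\sharp(\alpha)\rangle=\pi(\alpha,\beta)$. A symplectic form is a closed non-degenerate $2$-form; its inverse Poisson bivector $\pi$ satisfies $\omega^\flat\circ\pi^\sharp=\mathrm{Id}_{A^*}$, $\pi^\sharp\circ\omega^\flat=\mathrm{Id}_A$. All indices are in $\mathbb{Z}_3=\{1,2,3\}$. Given symplectic forms $\omega_1,\omega_2,\omega_3$ with inverses $\pi_1,\pi_2,\pi_3$, the transition tensors are $N_i:=\pi_{i-1}^\sharp\circ\omega_{i+1}^\flat$. The triple is an $\boldsymbol\varepsilon$-hypersymplectic structure, $\boldsymbol\varepsilon=(\varepsilon_1,\varepsilon_2,\varepsilon_3)$ with $\varepsilon_i=\pm1$, if $N_i^2=\varepsilon_i\mathrm{Id}_A$ for $i=1,2,3$. For a bundle endomorphism $N$ of $A$ with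 transpose $N^*$: $[X,Y]_N=[NX,Y]+[X,NY]-N[X,Y]$ and $\mathcal TN(X,Y)=[NX,NY]-N[X,Y]_N$. For a bivector $\pi$, $[\alpha,\beta]_\pi=\mathcal L_{\pi^\sharp\alpha}\beta-\mathcal L_{\pi^\sharp\beta}\alpha-\mathrm d(\pi(\alpha,\beta))$ on $\Gamma(A^* )$, where $\mathcal L$ is the Lie derivative of the Lie algebroid. The Magri–Morosi concomitant is $C_{\pi,N}(\alpha,\beta)=([\alpha,\beta]_N)_\pi-([\alpha,\beta]_\pi)_{N^*}$, where $([\cdot,\cdot]_N)_\pi$ is the bracket on $\Gamma(A^* )$ obtained by the formula for $[\cdot,\cdot]_\pi$ applied to the deformed structure $(\rho\circ N,[\cdot,\cdot]_N)$ on $A$, and $([\alpha,\beta]_\pi)_{N^*}=[N^*\alpha,\beta]_\pi+[\alpha,N^*\beta]_\pi-N^*[\alpha,\beta]_\pi$. $(\pi,N)$ is a $PN$ structure if $[\pi,\pi]=0$ (Schouten–Nijenhuis bracket), $\mathcal TN=0$, $N\circ\pi^\sharp=\pi^\sharp\circ N^*$ and $C_{\pi,N}=0$. $(\omega,N)$, with $\omega$ a $2$-form, is an $\Omega N$ structure if $\mathrm d\omega=0$, $\mathcal TN=0$, $\omega^\flat\circ N=N^*\circ\omega^\flat$ and $\mathrm d(\omega_N)=0$, where $\omega_N(X,Y)=\omega(NX,Y)$. *)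

theory Defs
  imports "HOL-Analysis.Analysis"
begin

section \<open>Smooth manifolds\<close>

text \<open>Points of Euclidean space of dimension \<open>n\<close> are functions \<open>x :: nat \<Rightarrow> real\<close> with \<open>x i = 0\<close> for
  \<open>i \<ge> n\<close>, as in the library topology \<^const>\<open>Euclidean_space\<close>; this includes \<open>n = 0\<close>.\<close>

definition partial_deriv :: "nat \<Rightarrow> ((nat \<Rightarrow> real) \<Rightarrow> real) \<Rightarrow> (nat \<Rightarrow> real) \<Rightarrow> real"
  where "partial_deriv i f x = deriv (\<lambda>t. f (x(i := t))) (x i)"

text \<open>All partial derivatives of order at most \<open>k\<close> exist and are continuous on \<open>V\<close>, for \<open>V\<close> open in
  \<open>Euclidean_space n\<close>.\<close>

primrec C_k_on :: "nat \<Rightarrow> nat \<Rightarrow> (nat \<Rightarrow> real) set \<Rightarrow> ((nat \<Rightarrow> real) \<Rightarrow> real) \<Rightarrow> bool"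
  where
    "C_k_on n 0 V f \<longleftrightarrow> continuous_on V f"
  | "C_k_on n (Suc k) V f \<longleftrightarrow> continuous_on V f \<and>
       (\<forall>i<n. (\<forall>x\<in>V. (\<lambda>t. f (x(i := t))) field_differentiable at (x i)) \<and>
              C_k_on n k V (partial_deriv i f))"

definition C_inf_on :: "nat \<Rightarrow> (nat \<Rightarrow> real) set \<Rightarrow> ((nat \<Rightarrow> real) \<Rightarrow> real) \<Rightarrow> bool"
  where "C_inf_on n V f \<longleftrightarrow> (\<forall>k. C_k_on n k V f)"

text \<open>The underlying topological space is the whole type \<open>'m\<close>. A chart is a pair of its domain and
  its coordinate map; the atlas need not be maximal.\<close>

record 'm manifold =
  mdim :: nat
  charts :: "('m set \<times> ('m \<Rightarrow> nat \<Rightarrow> real)) set"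

definition smooth_manifold ::
    "('m::{t2_space,second_countable_topology}, 'z) manifold_scheme \<Rightarrow> bool"
  where "smooth_manifold M \<longleftrightarrow>
    (\<Union>(U, \<phi>)\<in>charts M. U) = UNIV \<and>
    (\<forall>(U, \<phi>)\<in>charts M. open U \<and> openin (Euclidean_space (mdim M)) (\<phi> ` U) \<and>
       homeomorphic_map (top_of_set U) (subtopology (Euclidean_space (mdim M)) (\<phi> ` U)) \<phi>) \<and>
    (\<forall>(U, \<phi>)\<in>charts M. \<forall>(V, \<psi>)\<in>charts M. \<forall>i<mdim M.
       C_inf_on (mdim M) (\<phi> ` (U \<inter> V)) (\<lambda>y. \<psi> (inv_into U \<phi> y) i))"

definition smooth_on :: "('m, 'z) manifold_scheme \<Rightarrow> 'm set \<Rightarrow> ('m \<Rightarrow> real) \<Rightarrow> bool"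
  where "smooth_on M U f \<longleftrightarrow>
    (\<forall>(V, \<phi>)\<in>charts M. C_inf_on (mdim M) (\<phi> ` (U \<inter> V)) (\<lambda>y. f (inv_into V \<phi> y)))"

definition smooth_funs :: "('m, 'z) manifold_scheme \<Rightarrow> ('m \<Rightarrow> real) set"
  where "smooth_funs M = {f. smooth_on M UNIV f}"

text \<open>Tangent vectors at \<open>x\<close> are derivations at \<open>x\<close> of the algebra of smooth functions.\<close>

definition tangent_vector ::
    "('m, 'z) manifold_scheme \<Rightarrow> 'm \<Rightarrow> (('m \<Rightarrow> real) \<Rightarrow> real) \<Rightarrow> bool"
  where "tangent_vector M x D \<longleftrightarrow>
    (\<forall>f\<in>smooth_funs M. \<forall>g\<in>smooth_funs M.
       D (\<lambda>y. f y + g y) = D f + D g \<and>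
       D (\<lambda>y. f y * g y) = D f * g x + f x * D g) \<and>
    (\<forall>c. \<forall>f\<in>smooth_funs M. D (\<lambda>y. c * f y) = c * D f)"


section \<open>Vector bundles\<close>

text \<open>The fibres are subspaces of some real vector space \<open>'v\<close>. This only serves to give them a
  common type: \<open>'v\<close> is not assumed to carry a topology, and the identification of vectors in
  different fibres plays no role. The smooth structure of the bundle is given by local
  frames \<open>(U, e)\<close>, with \<open>e 0 x, \<dots>, e (r - 1) x\<close> a basis of the fibre at each \<open>x \<in> U\<close>, that is, by
  the inverses of local trivializations \<open>U \<times> \<real>\<^sup>r\<close>; the transition matrices are smooth.\<close>

record ('m, 'v) vector_bundle = "'m manifold" +
  bundle_rank :: nat
  fibre :: "'m \<Rightarrow> 'v set"
  frames :: "('m set \<times> (nat \<Rightarrow> 'm \<Rightarrow> 'v)) set"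

definition vector_bundle ::
    "('m::{t2_space,second_countable_topology}, 'v::real_vector, 'z) vector_bundle_scheme \<Rightarrow> bool"
  where "vector_bundle A \<longleftrightarrow>
    smooth_manifold A \<and>
    (\<forall>x. subspace (fibre A x)) \<and>
    (\<Union>(U, e)\<in>frames A. U) = UNIV \<and>
    (\<forall>(U, e)\<in>frames A. open U \<and>
       (\<forall>x\<in>U. inj_on (\<lambda>i. e i x) {..<bundle_rank A} \<and>
              independent ((\<lambda>i. e i x) ` {..<bundle_rank A}) \<and>
              span ((\<lambda>i. e i x) ` {..<bundle_rank A}) = fibre A x)) \<and>
    (\<forall>(U, e)\<in>frames A. \<forall>(V, e')\<in>frames A. \<forall>j<bundle_rank A.
       \<exists>c. (\<forall>i<bundle_rank A. smooth_on A (U \<inter> V) (c i)) \<and>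
           (\<forall>x\<in>U \<inter> V. e' j x = (\<Sum>i<bundle_rank A. c i x *\<^sub>R e i x)))"

definition smooth_sections ::
    "('m, 'v::real_vector, 'z) vector_bundle_scheme \<Rightarrow> ('m \<Rightarrow> 'v) set"
  where "smooth_sections A = {X. (\<forall>x. X x \<in> fibre A x) \<and>
    (\<forall>(U, e)\<in>frames A. \<exists>c. (\<forall>i<bundle_rank A. smooth_on A U (c i)) \<and>
       (\<forall>x\<in>U. X x = (\<Sum>i<bundle_rank A. c i x *\<^sub>R e i x)))}"

definition lin_on :: "'v::real_vector set \<Rightarrow> ('v \<Rightarrow> 'w::real_vector) \<Rightarrow> bool"
  where "lin_on S h \<longleftrightarrow>
    (\<forall>u\<in>S. \<forall>v\<in>S. h (u + v) = h u + h v) \<and> (\<forall>c. \<forall>u\<in>S. h (c *\<^sub>R u) = c *\<^sub>R h u)"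

text \<open>A covector at \<open>x\<close> is a function on all of \<open>'v\<close>, extended by \<open>0\<close> outside the fibre, so that
  equality of covectors is equality of functions.\<close>

definition dual_fibre :: "('m, 'v::real_vector, 'z) vector_bundle_scheme \<Rightarrow> 'm \<Rightarrow> ('v \<Rightarrow> real) set"
  where "dual_fibre A x = {\<phi>. lin_on (fibre A x) \<phi> \<and> (\<forall>v. v \<notin> fibre A x \<longrightarrow> \<phi> v = 0)}"

text \<open>The sections of the dual bundle.\<close>

definition one_forms :: "('m, 'v::real_vector, 'z) vector_bundle_scheme \<Rightarrow> ('m \<Rightarrow> 'v \<Rightarrow> real) set"
  where "one_forms A = {\<alpha>. (\<forall>x. \<alpha> x \<in> dual_fibre A x) \<and>
    (\<forall>(U, e)\<in>frames A. \<forall>i<bundle_rank A. smooth_on A U (\<lambda>x. \<alpha> x (e i x)))}"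

text \<open>The dual frame; \<^const>\<open>representation\<close> vanishes outside the span of the basis.\<close>

definition coframe ::
    "('m, 'v::real_vector, 'z) vector_bundle_scheme \<Rightarrow> (nat \<Rightarrow> 'm \<Rightarrow> 'v) \<Rightarrow> nat \<Rightarrow> 'm \<Rightarrow> 'v \<Rightarrow> real"
  where "coframe A e i x =
    (\<lambda>v. representation ((\<lambda>j. e j x) ` {..<bundle_rank A}) v (e i x))"

definition two_forms ::
    "('m, 'v::real_vector, 'z) vector_bundle_scheme \<Rightarrow> ('m \<Rightarrow> 'v \<Rightarrow> 'v \<Rightarrow> real) set"
  where "two_forms A = {\<omega>.
    (\<forall>x. \<forall>v\<in>fibre A x. lin_on (fibre A x) (\<omega> x v) \<and> lin_on (fibre A x) (\<lambda>u. \<omega> x u v) \<and>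
       \<omega> x v v = 0) \<and>
    (\<forall>(U, e)\<in>frames A. \<forall>i<bundle_rank A. \<forall>j<bundle_rank A.
       smooth_on A U (\<lambda>x. \<omega> x (e i x) (e j x)))}"

text \<open>A section of the second exterior power is encoded as a smooth family of alternating bilinear
  forms on the dual fibres.\<close>

definition bivectors ::
    "('m, 'v::real_vector, 'z) vector_bundle_scheme \<Rightarrow>
     ('m \<Rightarrow> ('v \<Rightarrow> real) \<Rightarrow> ('v \<Rightarrow> real) \<Rightarrow> real) set"
  where "bivectors A = {\<pi>.
    (\<forall>x. \<forall>\<phi>\<in>dual_fibre A x. \<forall>\<psi>\<in>dual_fibre A x. \<forall>\<theta>\<in>dual_fibre A x. \<forall>c.
       \<pi> x (\<lambda>v. \<phi> v + \<psi> v) \<theta> = \<pi> x \<phi> \<theta> + \<pi> x \<psi> \<theta> \<and>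
       \<pi> x \<theta> (\<lambda>v. \<phi> v + \<psi> v) = \<pi> x \<theta> \<phi> + \<pi> x \<theta> \<psi> \<and>
       \<pi> x (\<lambda>v. c * \<phi> v) \<theta> = c * \<pi> x \<phi> \<theta> \<and>
       \<pi> x \<theta> (\<lambda>v. c * \<phi> v) = c * \<pi> x \<theta> \<phi> \<and>
       \<pi> x \<phi> \<phi> = 0) \<and>
    (\<forall>(U, e)\<in>frames A. \<forall>i<bundle_rank A. \<forall>j<bundle_rank A.
       smooth_on A U (\<lambda>x. \<pi> x (coframe A e i x) (coframe A e j x)))}"

definition bundle_endos ::
    "('m, 'v::real_vector, 'z) vector_bundle_scheme \<Rightarrow> ('m \<Rightarrow> 'v \<Rightarrow> 'v) set"
  where "bundle_endos A = {N.
    (\<forall>x. lin_on (fibre A x) (N x) \<and> (\<forall>v\<in>fibre A x. N x v \<in> fibre A x)) \<and>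
    (\<forall>(U, e)\<in>frames A. \<forall>j<bundle_rank A.
       \<exists>c. (\<forall>i<bundle_rank A. smooth_on A U (c i)) \<and>
           (\<forall>x\<in>U. N x (e j x) = (\<Sum>i<bundle_rank A. c i x *\<^sub>R e i x)))}"

text \<open>The transpose of an endomorphism, and the musical maps
  \<open>\<langle>\<omega>\<^sup>\<flat>(X), Y\<rangle> = \<omega>(X, Y)\<close> and \<open>\<langle>\<beta>, \<pi>\<^sup>\<sharp>(\<alpha>)\<rangle> = \<pi>(\<alpha>, \<beta>)\<close>. The description in \<open>sharp\<close> is
  proper because a fibre, being finite dimensional, is its own bidual.\<close>

definition transpose_endo ::
    "('m, 'v::real_vector, 'z) vector_bundle_scheme \<Rightarrow> ('m \<Rightarrow> 'v \<Rightarrow> 'v) \<Rightarrow>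
     'm \<Rightarrow> ('v \<Rightarrow> real) \<Rightarrow> 'v \<Rightarrow> real"
  where "transpose_endo A N x \<phi> = (\<lambda>v. if v \<in> fibre A x then \<phi> (N x v) else 0)"

definition flat ::
    "('m, 'v::real_vector, 'z) vector_bundle_scheme \<Rightarrow> ('m \<Rightarrow> 'v \<Rightarrow> 'v \<Rightarrow> real) \<Rightarrow>
     'm \<Rightarrow> 'v \<Rightarrow> 'v \<Rightarrow> real"
  where "flat A \<omega> x v = (\<lambda>w. if w \<in> fibre A x then \<omega> x v w else 0)"

definition sharp ::
    "('m, 'v::real_vector, 'z) vector_bundle_scheme \<Rightarrow>
     ('m \<Rightarrow> ('v \<Rightarrow> real) \<Rightarrow> ('v \<Rightarrow> real) \<Rightarrow> real) \<Rightarrow> 'm \<Rightarrow> ('v \<Rightarrow> real) \<Rightarrow> 'v"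
  where "sharp A \<pi> x \<phi> = (THE v. v \<in> fibre A x \<and> (\<forall>\<psi>\<in>dual_fibre A x. \<psi> v = \<pi> x \<phi> \<psi>))"

text \<open>The maps induced on sections by a fibrewise map.\<close>

definition on_sections :: "('m \<Rightarrow> 'a \<Rightarrow> 'b) \<Rightarrow> ('m \<Rightarrow> 'a) \<Rightarrow> 'm \<Rightarrow> 'b"
  where "on_sections F s = (\<lambda>x. F x (s x))"


section \<open>Lie algebroids\<close>

text \<open>The anchor sends a vector of the fibre at \<open>x\<close> to a tangent vector at \<open>x\<close>. That it preserves
  brackets is a consequence of the other axioms, and is not among them.\<close>

record ('m, 'v) lie_algebroid = "('m, 'v) vector_bundle" +
  anchor :: "'m \<Rightarrow> 'v \<Rightarrow> ('m \<Rightarrow> real) \<Rightarrow> real"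
  bracket :: "('m \<Rightarrow> 'v) \<Rightarrow> ('m \<Rightarrow> 'v) \<Rightarrow> 'm \<Rightarrow> 'v"

definition anchor_on :: "('m, 'v, 'z) lie_algebroid_scheme \<Rightarrow> ('m \<Rightarrow> 'v) \<Rightarrow> ('m \<Rightarrow> real) \<Rightarrow> 'm \<Rightarrow> real"
  where "anchor_on A X f = (\<lambda>x. anchor A x (X x) f)"

definition lie_algebroid ::
    "('m::{t2_space,second_countable_topology}, 'v::real_vector, 'z) lie_algebroid_scheme \<Rightarrow> bool"
  where "lie_algebroid A \<longleftrightarrow>
    vector_bundle A \<and>
    (\<forall>x. \<forall>v\<in>fibre A x. tangent_vector A x (anchor A x v)) \<and>
    (\<forall>x. \<forall>f\<in>smooth_funs A. lin_on (fibre A x) (\<lambda>v. anchor A x v f)) \<and>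
    (\<forall>X\<in>smooth_sections A. \<forall>f\<in>smooth_funs A. anchor_on A X f \<in> smooth_funs A) \<and>
    (\<forall>X\<in>smooth_sections A. \<forall>Y\<in>smooth_sections A.
       bracket A X Y \<in> smooth_sections A \<and>
       bracket A X Y = (\<lambda>x. - bracket A Y X x) \<and>
       (\<forall>c. bracket A X (\<lambda>x. c *\<^sub>R Y x) = (\<lambda>x. c *\<^sub>R bracket A X Y x)) \<and>
       (\<forall>f\<in>smooth_funs A. bracket A X (\<lambda>x. f x *\<^sub>R Y x) =
          (\<lambda>x. f x *\<^sub>R bracket A X Y x + anchor_on A X f x *\<^sub>R Y x))) \<and>
    (\<forall>X\<in>smooth_sections A. \<forall>Y\<in>smooth_sections A. \<forall>Z\<in>smooth_sections A.
       bracket A X (\<lambda>x. Y x + Z x) = (\<lambda>x. bracket A X Y x + bracket A X Z x) \<and>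
       (\<forall>x. bracket A X (bracket A Y Z) x + bracket A Y (bracket A Z X) x +
            bracket A Z (bracket A X Y) x = 0))"

text \<open>Sections of tensor bundles that result from differential operations are given by their values
  on sections: \<open>differential2 A \<omega> X Y Z\<close> is the function \<open>(d\<omega>)(X, Y, Z)\<close>, \<open>lie_derivative A X \<beta> Y\<close>
  is \<open>\<langle>\<L>\<^sub>X \<beta>, Y\<rangle>\<close>, and \<open>bivector_bracket A \<pi> \<alpha> \<beta> Y\<close> is \<open>\<langle>[\<alpha>, \<beta>]\<^sub>\<pi>, Y\<rangle>\<close>.\<close>

definition differential2 ::
    "('m, 'v, 'z) lie_algebroid_scheme \<Rightarrow> ('m \<Rightarrow> 'v \<Rightarrow> 'v \<Rightarrow> real) \<Rightarrow>
     ('m \<Rightarrow> 'v) \<Rightarrow> ('m \<Rightarrow> 'v) \<Rightarrow> ('m \<Rightarrow> 'v) \<Rightarrow> 'm \<Rightarrow> real"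
  where "differential2 A \<omega> X Y Z = (\<lambda>x.
      anchor_on A X (\<lambda>y. \<omega> y (Y y) (Z y)) x
    - anchor_on A Y (\<lambda>y. \<omega> y (X y) (Z y)) x
    + anchor_on A Z (\<lambda>y. \<omega> y (X y) (Y y)) x
    - \<omega> x (bracket A X Y x) (Z x)
    + \<omega> x (bracket A X Z x) (Y x)
    - \<omega> x (bracket A Y Z x) (X x))"

definition closed2 ::
    "('m, 'v::real_vector, 'z) lie_algebroid_scheme \<Rightarrow> ('m \<Rightarrow> 'v \<Rightarrow> 'v \<Rightarrow> real) \<Rightarrow> bool"
  where "closed2 A \<omega> \<longleftrightarrow>
    (\<forall>X\<in>smooth_sections A. \<forall>Y\<in>smooth_sections A. \<forall>Z\<in>smooth_sections A. \<forall>x.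
       differential2 A \<omega> X Y Z x = 0)"

definition lie_derivative ::
    "('m, 'v, 'z) lie_algebroid_scheme \<Rightarrow> ('m \<Rightarrow> 'v) \<Rightarrow> ('m \<Rightarrow> 'v \<Rightarrow> real) \<Rightarrow>
     ('m \<Rightarrow> 'v) \<Rightarrow> 'm \<Rightarrow> real"
  where "lie_derivative A X \<beta> Y = (\<lambda>x.
    anchor_on A X (\<lambda>y. \<beta> y (Y y)) x - \<beta> x (bracket A X Y x))"

definition bivector_bracket ::
    "('m, 'v::real_vector, 'z) lie_algebroid_scheme \<Rightarrow>
     ('m \<Rightarrow> ('v \<Rightarrow> real) \<Rightarrow> ('v \<Rightarrow> real) \<Rightarrow> real) \<Rightarrow>
     ('m \<Rightarrow> 'v \<Rightarrow> real) \<Rightarrow> ('m \<Rightarrow> 'v \<Rightarrow> real) \<Rightarrow> ('m \<Rightarrow> 'v) \<Rightarrow> 'm \<Rightarrow> real"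
  where "bivector_bracket A \<pi> \<alpha> \<beta> Y = (\<lambda>x.
      lie_derivative A (on_sections (sharp A \<pi>) \<alpha>) \<beta> Y x
    - lie_derivative A (on_sections (sharp A \<pi>) \<beta>) \<alpha> Y x
    - anchor_on A Y (\<lambda>y. \<pi> y (\<alpha> y) (\<beta> y)) x)"

text \<open>The Schouten--Nijenhuis bracket of two bivectors, evaluated on three 1-forms, by the formula
  \<open>[P, Q](\<alpha>, \<beta>, \<gamma>) = \<Sum> \<langle>\<L>\<^bsub>P\<^sup>\<sharp>\<alpha>\<^esub> \<beta>, Q\<^sup>\<sharp>\<gamma>\<rangle> + \<langle>\<L>\<^bsub>Q\<^sup>\<sharp>\<alpha>\<^esub> \<beta>, P\<^sup>\<sharp>\<gamma>\<rangle>\<close>, summed over the cyclic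
  permutations of \<open>(\<alpha>, \<beta>, \<gamma>)\<close>. The theorem \<open>schouten_wedge\<close> below shows that it has the
  defining property of the bracket: on \<open>X\<^sub>1 \<and> X\<^sub>2\<close> and \<open>Y\<^sub>1 \<and> Y\<^sub>2\<close> it is
  \<open>\<Sum> (-1)\<^bsup>i+j\<^esup> [X\<^sub>i, Y\<^sub>j] \<and> X\<^bsub>3-i\<^esub> \<and> Y\<^bsub>3-j\<^esub>\<close>; the formula is local and additive in each
  bivector, and bivectors are locally sums of decomposable ones.\<close>

definition schouten_cyclic_term ::
    "('m, 'v::real_vector, 'z) lie_algebroid_scheme \<Rightarrow>
     ('m \<Rightarrow> ('v \<Rightarrow> real) \<Rightarrow> ('v \<Rightarrow> real) \<Rightarrow> real) \<Rightarrow> ('m \<Rightarrow> ('v \<Rightarrow> real) \<Rightarrow> ('v \<Rightarrow> real) \<Rightarrow> real) \<Rightarrow>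
     ('m \<Rightarrow> 'v \<Rightarrow> real) \<Rightarrow> ('m \<Rightarrow> 'v \<Rightarrow> real) \<Rightarrow> ('m \<Rightarrow> 'v \<Rightarrow> real) \<Rightarrow> 'm \<Rightarrow> real"
  where "schouten_cyclic_term A P Q \<alpha> \<beta> \<gamma> = (\<lambda>x.
      lie_derivative A (on_sections (sharp A P) \<alpha>) \<beta> (on_sections (sharp A Q) \<gamma>) x
    + lie_derivative A (on_sections (sharp A Q) \<alpha>) \<beta> (on_sections (sharp A P) \<gamma>) x)"

definition schouten_bracket ::
    "('m, 'v::real_vector, 'z) lie_algebroid_scheme \<Rightarrow>
     ('m \<Rightarrow> ('v \<Rightarrow> real) \<Rightarrow> ('v \<Rightarrow> real) \<Rightarrow> real) \<Rightarrow> ('m \<Rightarrow> ('v \<Rightarrow> real) \<Rightarrow> ('v \<Rightarrow> real) \<Rightarrow> real) \<Rightarrow>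
     ('m \<Rightarrow> 'v \<Rightarrow> real) \<Rightarrow> ('m \<Rightarrow> 'v \<Rightarrow> real) \<Rightarrow> ('m \<Rightarrow> 'v \<Rightarrow> real) \<Rightarrow> 'm \<Rightarrow> real"
  where "schouten_bracket A P Q \<alpha> \<beta> \<gamma> = (\<lambda>x.
    schouten_cyclic_term A P Q \<alpha> \<beta> \<gamma> x + schouten_cyclic_term A P Q \<beta> \<gamma> \<alpha> x +
    schouten_cyclic_term A P Q \<gamma> \<alpha> \<beta> x)"

definition deformed_bracket ::
    "('m, 'v::real_vector, 'z) lie_algebroid_scheme \<Rightarrow> ('m \<Rightarrow> 'v \<Rightarrow> 'v) \<Rightarrow>
     ('m \<Rightarrow> 'v) \<Rightarrow> ('m \<Rightarrow> 'v) \<Rightarrow> 'm \<Rightarrow> 'v"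
  where "deformed_bracket A N X Y = (\<lambda>x.
    bracket A (on_sections N X) Y x + bracket A X (on_sections N Y) x - N x (bracket A X Y x))"

definition torsion ::
    "('m, 'v::real_vector, 'z) lie_algebroid_scheme \<Rightarrow> ('m \<Rightarrow> 'v \<Rightarrow> 'v) \<Rightarrow>
     ('m \<Rightarrow> 'v) \<Rightarrow> ('m \<Rightarrow> 'v) \<Rightarrow> 'm \<Rightarrow> 'v"
  where "torsion A N X Y = (\<lambda>x.
    bracket A (on_sections N X) (on_sections N Y) x - N x (deformed_bracket A N X Y x))"

definition torsion_free ::
    "('m, 'v::real_vector, 'z) lie_algebroid_scheme \<Rightarrow> ('m \<Rightarrow> 'v \<Rightarrow> 'v) \<Rightarrow> bool"
  where "torsion_free A N \<longleftrightarrow>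
    (\<forall>X\<in>smooth_sections A. \<forall>Y\<in>smooth_sections A. \<forall>x. torsion A N X Y x = 0)"

text \<open>The structure \<open>(\<rho> \<circ> N, [\<cdot>, \<cdot>]\<^sub>N)\<close> on the same vector bundle; in general not a Lie algebroid.\<close>

definition deformed ::
    "('m, 'v::real_vector, 'z) lie_algebroid_scheme \<Rightarrow> ('m \<Rightarrow> 'v \<Rightarrow> 'v) \<Rightarrow>
     ('m, 'v, 'z) lie_algebroid_scheme"
  where "deformed A N =
    A\<lparr>anchor := (\<lambda>x v. anchor A x (N x v)), bracket := deformed_bracket A N\<rparr>"

text \<open>\<open>\<langle>C(\<alpha>, \<beta>), Y\<rangle>\<close>; here \<open>\<langle>N\<^sup>*[\<alpha>, \<beta>]\<^sub>\<pi>, Y\<rangle> = \<langle>[\<alpha>, \<beta>]\<^sub>\<pi>, N Y\<rangle>\<close>.\<close>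

definition magri_morosi ::
    "('m, 'v::real_vector, 'z) lie_algebroid_scheme \<Rightarrow>
     ('m \<Rightarrow> ('v \<Rightarrow> real) \<Rightarrow> ('v \<Rightarrow> real) \<Rightarrow> real) \<Rightarrow> ('m \<Rightarrow> 'v \<Rightarrow> 'v) \<Rightarrow>
     ('m \<Rightarrow> 'v \<Rightarrow> real) \<Rightarrow> ('m \<Rightarrow> 'v \<Rightarrow> real) \<Rightarrow> ('m \<Rightarrow> 'v) \<Rightarrow> 'm \<Rightarrow> real"
  where "magri_morosi A \<pi> N \<alpha> \<beta> Y = (\<lambda>x.
    bivector_bracket (deformed A N) \<pi> \<alpha> \<beta> Y x
    - (bivector_bracket A \<pi> (on_sections (transpose_endo A N) \<alpha>) \<beta> Y x
       + bivector_bracket A \<pi> \<alpha> (on_sections (transpose_endo A N) \<beta>) Y x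
       - bivector_bracket A \<pi> \<alpha> \<beta> (on_sections N Y) x))"

definition PN_structure ::
    "('m, 'v::real_vector, 'z) lie_algebroid_scheme \<Rightarrow>
     ('m \<Rightarrow> ('v \<Rightarrow> real) \<Rightarrow> ('v \<Rightarrow> real) \<Rightarrow> real) \<Rightarrow> ('m \<Rightarrow> 'v \<Rightarrow> 'v) \<Rightarrow> bool"
  where "PN_structure A \<pi> N \<longleftrightarrow>
    \<pi> \<in> bivectors A \<and> N \<in> bundle_endos A \<and>
    (\<forall>\<alpha>\<in>one_forms A. \<forall>\<beta>\<in>one_forms A. \<forall>\<gamma>\<in>one_forms A. \<forall>x.
       schouten_bracket A \<pi> \<pi> \<alpha> \<beta> \<gamma> x = 0) \<and>
    torsion_free A N \<and>
    (\<forall>x. \<forall>\<phi>\<in>dual_fibre A x. N x (sharp A \<pi> x \<phi>) = sharp A \<pi> x (transpose_endo A N x \<phi>)) \<and>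
    (\<forall>\<alpha>\<in>one_forms A. \<forall>\<beta>\<in>one_forms A. \<forall>Y\<in>smooth_sections A. \<forall>x.
       magri_morosi A \<pi> N \<alpha> \<beta> Y x = 0)"

definition OmegaN_structure ::
    "('m, 'v::real_vector, 'z) lie_algebroid_scheme \<Rightarrow> ('m \<Rightarrow> 'v \<Rightarrow> 'v \<Rightarrow> real) \<Rightarrow>
     ('m \<Rightarrow> 'v \<Rightarrow> 'v) \<Rightarrow> bool"
  where "OmegaN_structure A \<omega> N \<longleftrightarrow>
    \<omega> \<in> two_forms A \<and> N \<in> bundle_endos A \<and>
    closed2 A \<omega> \<and>
    torsion_free A N \<and>
    (\<forall>x. \<forall>v\<in>fibre A x. flat A \<omega> x (N x v) = transpose_endo A N x (flat A \<omega> x v)) \<and>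
    closed2 A (\<lambda>x v w. \<omega> x (N x v) w)"


section \<open>Hypersymplectic structures\<close>

definition symplectic_form ::
    "('m, 'v::real_vector, 'z) lie_algebroid_scheme \<Rightarrow> ('m \<Rightarrow> 'v \<Rightarrow> 'v \<Rightarrow> real) \<Rightarrow> bool"
  where "symplectic_form A \<omega> \<longleftrightarrow>
    \<omega> \<in> two_forms A \<and> closed2 A \<omega> \<and>
    (\<forall>x. \<forall>v\<in>fibre A x. (\<forall>w\<in>fibre A x. \<omega> x v w = 0) \<longrightarrow> v = 0)"

definition inverse_bivector ::
    "('m, 'v::real_vector, 'z) lie_algebroid_scheme \<Rightarrow> ('m \<Rightarrow> 'v \<Rightarrow> 'v \<Rightarrow> real) \<Rightarrow>
     ('m \<Rightarrow> ('v \<Rightarrow> real) \<Rightarrow> ('v \<Rightarrow> real) \<Rightarrow> real) \<Rightarrow> bool"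
  where "inverse_bivector A \<omega> \<pi> \<longleftrightarrow>
    \<pi> \<in> bivectors A \<and>
    (\<forall>x. (\<forall>\<phi>\<in>dual_fibre A x. flat A \<omega> x (sharp A \<pi> x \<phi>) = \<phi>) \<and>
         (\<forall>v\<in>fibre A x. sharp A \<pi> x (flat A \<omega> x v) = v))"

text \<open>Indices range over the library type \<open>3\<close> of integers modulo 3, whose elements are 1, 2 and
  3 = 0, with modular arithmetic.\<close>

definition transition_tensor ::
    "('m, 'v::real_vector, 'z) lie_algebroid_scheme \<Rightarrow>
     (3 \<Rightarrow> 'm \<Rightarrow> 'v \<Rightarrow> 'v \<Rightarrow> real) \<Rightarrow> (3 \<Rightarrow> 'm \<Rightarrow> ('v \<Rightarrow> real) \<Rightarrow> ('v \<Rightarrow> real) \<Rightarrow> real) \<Rightarrow>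
     3 \<Rightarrow> 'm \<Rightarrow> 'v \<Rightarrow> 'v"
  where "transition_tensor A \<omega> \<pi> i x v = sharp A (\<pi> (i - 1)) x (flat A (\<omega> (i + 1)) x v)"

definition hypersymplectic ::
    "('m, 'v::real_vector, 'z) lie_algebroid_scheme \<Rightarrow> (3 \<Rightarrow> real) \<Rightarrow>
     (3 \<Rightarrow> 'm \<Rightarrow> 'v \<Rightarrow> 'v \<Rightarrow> real) \<Rightarrow> (3 \<Rightarrow> 'm \<Rightarrow> ('v \<Rightarrow> real) \<Rightarrow> ('v \<Rightarrow> real) \<Rightarrow> real) \<Rightarrow> bool"
  where "hypersymplectic A \<epsilon> \<omega> \<pi> \<longleftrightarrow>
    (\<forall>i. \<epsilon> i = 1 \<or> \<epsilon> i = - 1) \<and>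
    (\<forall>i. symplectic_form A (\<omega> i)) \<and>
    (\<forall>i. inverse_bivector A (\<omega> i) (\<pi> i)) \<and>
    (\<forall>i x. \<forall>v\<in>fibre A x.
       transition_tensor A \<omega> \<pi> i x (transition_tensor A \<omega> \<pi> i x v) = \<epsilon> i *\<^sub>R v)"

section \<open>The Schouten bracket of decomposable bivectors\<close>

text \<open>The rest of the theory proves \<open>schouten_wedge\<close>, which justifies \<^const>\<open>schouten_bracket\<close>. The
  conventions are \<open>(X \<and> Y)(\<phi>, \<psi>) = \<phi>(X) \<psi>(Y) - \<phi>(Y) \<psi>(X)\<close> and the determinant for three factors.\<close>

subsection \<open>Smooth functions\<close>

lemma eventually_update_mem:
  assumes V: "openin (Euclidean_space n) V" and x: "x \<in> V" and i: "i < n"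
  shows "\<forall>\<^sub>F t in nhds (x i). x(i := t) \<in> V"
proof -
  have eu: "Euclidean_space n = top_of_set {x. \<forall>i\<ge>n. x i = 0}"
    by (simp add: Euclidean_space_def euclidean_product_topology)
  then obtain T where T: "open T" "V = {x. \<forall>i\<ge>n. x i = 0} \<inter> T"
    using V by (auto simp: openin_open)
  have "continuous_on UNIV (\<lambda>t. x(i := t))"
  proof (rule continuous_on_coordinatewise_then_product)
    show "continuous_on UNIV (\<lambda>t. (x(i := t)) j)" for j
      by (cases "j = i") (auto simp: continuous_on_id continuous_on_const)
  qed
  then have "open ((\<lambda>t. x(i := t)) -` T)"
    using T(1) by (simp add: continuous_on_open_vimage)
  moreover have "x i \<in> (\<lambda>t. x(i := t)) -` T"
    using x T by simp
  ultimately have "\<forall>\<^sub>F t in nhds (x i). t \<in> (\<lambda>t. x(i := t)) -` T"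
    by (rule eventually_nhds_in_open)
  then show ?thesis
    by eventually_elim (use T x i in auto)
qed

lemma slice_cong:
  assumes V: "openin (Euclidean_space n) V" and x: "x \<in> V" and i: "i < n"
    and fg: "\<And>y. y \<in> V \<Longrightarrow> f y = g y"
  shows "(\<lambda>t. f (x(i := t))) field_differentiable at (x i) \<longleftrightarrow>
         (\<lambda>t. g (x(i := t))) field_differentiable at (x i)"
    and "partial_deriv i f x = partial_deriv i g x"
proof -
  have ev: "\<forall>\<^sub>F t in nhds (x i). f (x(i := t)) = g (x(i := t))"
    using eventually_update_mem[OF V x i] by eventually_elim (rule fg)
  show "(\<lambda>t. f (x(i := t))) field_differentiable at (x i) \<longleftrightarrow>
         (\<lambda>t. g (x(i := t))) field_differentiable at (x i)"
    unfolding field_differentiable_def using DERIV_cong_ev[OF refl ev refl] by simp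
  show "partial_deriv i f x = partial_deriv i g x"
    unfolding partial_deriv_def by (rule deriv_cong_ev[OF ev refl])
qed

lemma C_k_on_cong:
  assumes V: "openin (Euclidean_space n) V" and "\<And>y. y \<in> V \<Longrightarrow> f y = g y" and "C_k_on n k V f"
  shows "C_k_on n k V g"
  using assms(2,3)
proof (induction k arbitrary: f g)
  case 0
  then show ?case by (simp add: continuous_on_cong[of V V f g])
next
  case (Suc k)
  have "C_k_on n k V (partial_deriv i g)" if "i < n" for i
    using Suc.IH[of "partial_deriv i f" "partial_deriv i g"] Suc.prems that slice_cong(2)[OF V _ that, of _ f g]
    by auto
  moreover have "continuous_on V g"
    using Suc.prems continuous_on_cong[of V V f g] by simp
  ultimately show ?case
    using Suc.prems slice_cong(1)[OF V, of _ _ f g] by auto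
qed

lemma C_k_on_continuous: "C_k_on n k V f \<Longrightarrow> continuous_on V f"
  by (cases k) auto

lemma C_k_on_subset: "C_k_on n k V f \<Longrightarrow> W \<subseteq> V \<Longrightarrow> C_k_on n k W f"
  by (induction k arbitrary: f) (auto intro: continuous_on_subset)

lemma C_k_on_local:
  assumes V: "openin (Euclidean_space n) V"
    and "\<And>x. x \<in> V \<Longrightarrow> \<exists>W\<subseteq>V. openin (Euclidean_space n) W \<and> x \<in> W \<and> C_k_on n k W f"
  shows "C_k_on n k V f"
  using assms(2)
proof (induction k arbitrary: f)
  have eu: "Euclidean_space n = top_of_set {x. \<forall>i\<ge>n. x i = 0}"
    by (simp add: Euclidean_space_def euclidean_product_topology)
  have cont: "continuous_on V f"
    if *: "\<And>x. x \<in> V \<Longrightarrow> \<exists>W\<subseteq>V. openin (Euclidean_space n) W \<and> x \<in> W \<and> continuous_on W f"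
    for f :: "(nat \<Rightarrow> real) \<Rightarrow> real"
    unfolding continuous_on_eq_continuous_within
  proof
    fix x assume x: "x \<in> V"
    then obtain W where W: "W \<subseteq> V" "openin (Euclidean_space n) W" "x \<in> W" "continuous_on W f"
      using *[OF x] by (elim exE conjE)
    obtain T where T: "open T" "W = {x. \<forall>i\<ge>n. x i = 0} \<inter> T"
      using W(2) by (auto simp: eu openin_open)
    obtain T' where T': "V = {x. \<forall>i\<ge>n. x i = 0} \<inter> T'"
      using V by (auto simp: eu openin_open)
    have "at x within V = at x within W"
      by (rule at_within_nhd[of _ T]) (use T T' W in auto)
    then show "continuous (at x within V) f"
      using W by (simp add: continuous_on_eq_continuous_within)
  qed
  {
    case 0
    then show ?case using cont by simp
  next
    case (Suc k)
    have "continuous_on V f"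
    proof (rule cont)
      fix x assume "x \<in> V"
      from Suc.prems[OF this] obtain W where "W \<subseteq> V" "openin (Euclidean_space n) W" "x \<in> W"
        "C_k_on n (Suc k) W f" by (elim exE conjE)
      then show "\<exists>W\<subseteq>V. openin (Euclidean_space n) W \<and> x \<in> W \<and> continuous_on W f"
        by (intro exI[of _ W] conjI C_k_on_continuous)
    qed
    moreover have "(\<lambda>t. f (x(i := t))) field_differentiable at (x i)" if "x \<in> V" "i < n" for x i
    proof -
      from Suc.prems[OF that(1)] obtain W where "x \<in> W" "C_k_on n (Suc k) W f"
        by (elim exE conjE)
      then show ?thesis using that(2) by simp
    qed
    moreover have "C_k_on n k V (partial_deriv i f)" if "i < n" for i
    proof (rule Suc.IH)
      fix x assume "x \<in> V"
      from Suc.prems[OF this] obtain W where W: "W \<subseteq> V" "openin (Euclidean_space n) W" "x \<in> W"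
        "C_k_on n (Suc k) W f" by (elim exE conjE)
      then show "\<exists>W\<subseteq>V. openin (Euclidean_space n) W \<and> x \<in> W \<and> C_k_on n k W (partial_deriv i f)"
        using that by (intro exI[of _ W] conjI) simp_all
    qed
    ultimately show ?case by auto
  }
qed

lemma C_k_on_const: "C_k_on n k V (\<lambda>x. c)"
proof (induction k arbitrary: c)
  case (Suc k)
  have "partial_deriv i (\<lambda>x. c) = (\<lambda>x. 0)" for i
    by (simp add: partial_deriv_def fun_eq_iff)
  then show ?case using Suc by simp
qed simp

lemma C_k_on_SucD:
  assumes "C_k_on n (Suc k) V f"
  shows "C_k_on n k V f"
  using assms
proof (induction k arbitrary: f)
  case (Suc k)
  then show ?case by (auto simp del: C_k_on.simps simp: C_k_on.simps(2)[of n "Suc k"] C_k_on.simps(2)[of n k])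
qed simp

lemma C_k_on_add:
  assumes V: "openin (Euclidean_space n) V"
  shows "C_k_on n k V f \<Longrightarrow> C_k_on n k V g \<Longrightarrow> C_k_on n k V (\<lambda>x. f x + g x)"
proof (induction k arbitrary: f g)
  case (Suc k)
  have "C_k_on n k V (partial_deriv i (\<lambda>x. f x + g x))" if i: "i < n" for i
  proof (rule C_k_on_cong[OF V])
    show "C_k_on n k V (\<lambda>x. partial_deriv i f x + partial_deriv i g x)"
      using Suc i by auto
    show "partial_deriv i f x + partial_deriv i g x = partial_deriv i (\<lambda>x. f x + g x) x"
      if "x \<in> V" for x
      unfolding partial_deriv_def using Suc.prems i that by (subst deriv_add) auto
  qed
  then show ?case using Suc.prems by (auto intro!: continuous_on_add field_differentiable_add)
qed (auto intro: continuous_on_add)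

lemma C_k_on_mult:
  assumes V: "openin (Euclidean_space n) V"
  shows "C_k_on n k V f \<Longrightarrow> C_k_on n k V g \<Longrightarrow> C_k_on n k V (\<lambda>x. f x * g x)"
proof (induction k arbitrary: f g)
  case (Suc k)
  have "C_k_on n k V (partial_deriv i (\<lambda>x. f x * g x))" if i: "i < n" for i
  proof (rule C_k_on_cong[OF V])
    show "C_k_on n k V (\<lambda>x. f x * partial_deriv i g x + partial_deriv i f x * g x)"
      using Suc.prems i C_k_on_SucD[OF Suc.prems(1)] C_k_on_SucD[OF Suc.prems(2)]
      by (intro C_k_on_add[OF V] Suc.IH) auto
    show "f x * partial_deriv i g x + partial_deriv i f x * g x = partial_deriv i (\<lambda>x. f x * g x) x"
      if "x \<in> V" for x
      unfolding partial_deriv_def using Suc.prems i that by (subst deriv_mult) auto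
  qed
  then show ?case using Suc.prems by (auto intro!: continuous_on_mult field_differentiable_mult)
qed (auto intro: continuous_on_mult)

lemma chart_image_open:
  assumes M: "smooth_manifold M" and c: "(V, \<phi>) \<in> charts M" and U: "open U"
  shows "openin (Euclidean_space (mdim M)) (\<phi> ` (U \<inter> V))"
proof -
  have *: "openin (Euclidean_space (mdim M)) (\<phi> ` V)" "open V"
    "homeomorphic_map (top_of_set V) (subtopology (Euclidean_space (mdim M)) (\<phi> ` V)) \<phi>"
    using M c unfolding smooth_manifold_def by auto
  have "openin (top_of_set V) (U \<inter> V)" using U openin_open_Int[of U V] by (simp add: Int_commute)
  then have "openin (subtopology (Euclidean_space (mdim M)) (\<phi> ` V)) (\<phi> ` (U \<inter> V))"
    using *(3) by (meson homeomorphic_imp_open_map open_map_def)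
  then show ?thesis using *(1) by (meson openin_trans_full)
qed

lemma chart_inj:
  assumes M: "smooth_manifold M" and c: "(V, \<phi>) \<in> charts M"
  shows "inj_on \<phi> V"
proof -
  have "homeomorphic_map (top_of_set V) (subtopology (Euclidean_space (mdim M)) (\<phi> ` V)) \<phi>"
    using M c unfolding smooth_manifold_def by auto
  then show ?thesis by (auto dest: homeomorphic_imp_injective_map)
qed

lemma smooth_on_const: "smooth_on M U (\<lambda>x. c)"
  by (auto simp: smooth_on_def C_inf_on_def C_k_on_const)

lemma smooth_on_add:
  assumes "smooth_manifold M" "open U" "smooth_on M U f" "smooth_on M U g"
  shows "smooth_on M U (\<lambda>x. f x + g x)"
  using assms chart_image_open[OF assms(1) _ assms(2)]
  unfolding smooth_on_def C_inf_on_def by (fastforce intro: C_k_on_add)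

lemma smooth_on_mult:
  assumes "smooth_manifold M" "open U" "smooth_on M U f" "smooth_on M U g"
  shows "smooth_on M U (\<lambda>x. f x * g x)"
  using assms chart_image_open[OF assms(1) _ assms(2)]
  unfolding smooth_on_def C_inf_on_def by (fastforce intro: C_k_on_mult)

lemma smooth_on_sum:
  assumes "smooth_manifold M" "open U" "\<And>i. i < (r::nat) \<Longrightarrow> smooth_on M U (f i)"
  shows "smooth_on M U (\<lambda>x. \<Sum>i<r. f i x)"
  using assms(3) by (induction r) (auto intro: smooth_on_const smooth_on_add[OF assms(1,2)])

lemma smooth_on_subset: "smooth_on M U f \<Longrightarrow> W \<subseteq> U \<Longrightarrow> smooth_on M W f"
  unfolding smooth_on_def C_inf_on_def by (fastforce elim!: C_k_on_subset)

lemma smooth_on_cong: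
  assumes M: "smooth_manifold M" and U: "open U" and fg: "\<And>x. x \<in> U \<Longrightarrow> f x = g x" and f: "smooth_on M U f"
  shows "smooth_on M U g"
  unfolding smooth_on_def C_inf_on_def
proof (clarify)
  fix V \<phi> k assume c: "(V, \<phi>) \<in> charts M"
  have "C_k_on (mdim M) k (\<phi> ` (U \<inter> V)) (\<lambda>y. f (inv_into V \<phi> y))"
    using f c by (auto simp: smooth_on_def C_inf_on_def)
  then show "C_k_on (mdim M) k (\<phi> ` (U \<inter> V)) (\<lambda>y. g (inv_into V \<phi> y))"
    by (rule C_k_on_cong[OF chart_image_open[OF M c U], rotated]) (auto simp: fg inv_into_f_f[OF chart_inj[OF M c]])
qed


lemma smooth_on_UN:
  assumes M: "smooth_manifold M" and U: "\<And>U. U \<in> \<U> \<Longrightarrow> open U" "\<Union>\<U> = UNIV"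
    and f: "\<And>U. U \<in> \<U> \<Longrightarrow> smooth_on M U f"
  shows "f \<in> smooth_funs M"
  unfolding smooth_funs_def smooth_on_def C_inf_on_def mem_Collect_eq
proof (clarify)
  fix V \<phi> k assume c: "(V, \<phi>) \<in> charts M"
  show "C_k_on (mdim M) k (\<phi> ` (UNIV \<inter> V)) (\<lambda>y. f (inv_into V \<phi> y))"
  proof (rule C_k_on_local[OF chart_image_open[OF M c]])
    fix y assume "y \<in> \<phi> ` (UNIV \<inter> V)"
    then obtain x where x: "x \<in> V" "y = \<phi> x" by auto
    have "x \<in> \<Union>\<U>" by (simp add: U(2))
    then obtain U where "U \<in> \<U>" "x \<in> U" by blast
    note U' = this
    show "\<exists>W\<subseteq>\<phi> ` (UNIV \<inter> V). openin (Euclidean_space (mdim M)) W \<and> y \<in> W \<and>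
        C_k_on (mdim M) k W (\<lambda>y. f (inv_into V \<phi> y))"
    proof (intro exI[of _ "\<phi> ` (U \<inter> V)"] conjI)
      show "openin (Euclidean_space (mdim M)) (\<phi> ` (U \<inter> V))"
        by (rule chart_image_open[OF M c U(1)[OF U'(1)]])
      show "C_k_on (mdim M) k (\<phi> ` (U \<inter> V)) (\<lambda>y. f (inv_into V \<phi> y))"
        using bspec[OF f[OF U'(1), unfolded smooth_on_def C_inf_on_def] c] by simp
    qed (use x U' in auto)
  qed simp
qed

lemma smooth_funs_add: "smooth_manifold M \<Longrightarrow> f \<in> smooth_funs M \<Longrightarrow> g \<in> smooth_funs M \<Longrightarrow>
    (\<lambda>x. f x + g x) \<in> smooth_funs M"
  by (simp add: smooth_funs_def smooth_on_add)

lemma smooth_funs_mult: "smooth_manifold M \<Longrightarrow> f \<in> smooth_funs M \<Longrightarrow> g \<in> smooth_funs M \<Longrightarrow>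
    (\<lambda>x. f x * g x) \<in> smooth_funs M"
  by (simp add: smooth_funs_def smooth_on_mult)

lemma smooth_funs_uminus: "smooth_manifold M \<Longrightarrow> f \<in> smooth_funs M \<Longrightarrow> (\<lambda>x. - f x) \<in> smooth_funs M"
  using smooth_funs_mult[of M "\<lambda>x. - 1" f] by (simp add: smooth_funs_def smooth_on_const)


subsection \<open>Sections\<close>

lemma lin_on_0: "subspace S \<Longrightarrow> lin_on S h \<Longrightarrow> h 0 = 0"
  unfolding lin_on_def by (metis scaleR_zero_left subspace_0)

lemma lin_on_sum:
  assumes "subspace S" "lin_on S h" "\<And>i. i < (r::nat) \<Longrightarrow> e i \<in> S"
  shows "h (\<Sum>i<r. c i *\<^sub>R e i) = (\<Sum>i<r. c i *\<^sub>R h (e i))"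
  using assms(3)
proof (induction r)
  case (Suc r)
  have "(\<Sum>i<r. c i *\<^sub>R e i) \<in> S" "c r *\<^sub>R e r \<in> S"
    using Suc.prems assms(1) by (auto intro!: subspace_sum subspace_scale)
  then show ?case using Suc assms(2) by (simp add: lin_on_def)
qed (simp add: lin_on_0[OF assms(1,2)])

lemma vector_bundleD:
  assumes A: "vector_bundle A"
  shows "smooth_manifold A" "subspace (fibre A x)" "\<exists>U e. (U, e) \<in> frames A \<and> x \<in> U"
    and "(U, e) \<in> frames A \<Longrightarrow> open U"
    and "(U, e) \<in> frames A \<Longrightarrow> x \<in> U \<Longrightarrow> i < bundle_rank A \<Longrightarrow> e i x \<in> fibre A x"
    and "(U, e) \<in> frames A \<Longrightarrow> x \<in> U \<Longrightarrow> inj_on (\<lambda>i. e i x) {..<bundle_rank A} \<and>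
              independent ((\<lambda>i. e i x) ` {..<bundle_rank A}) \<and>
              span ((\<lambda>i. e i x) ` {..<bundle_rank A}) = fibre A x"
proof -
  note d = A[unfolded vector_bundle_def]
  note 1 = d[THEN conjunct1] d[THEN conjunct2, THEN conjunct1, rule_format]
    d[THEN conjunct2, THEN conjunct2, THEN conjunct1]
  note 2 = d[THEN conjunct2, THEN conjunct2, THEN conjunct2, THEN conjunct1]
  show "smooth_manifold A" "subspace (fibre A x)"
    by (rule 1)+
  show "(U, e) \<in> frames A \<Longrightarrow> open U"
    using bspec[OF 2, of "(U, e)"] by simp
  show fr: "(U, e) \<in> frames A \<Longrightarrow> x \<in> U \<Longrightarrow> inj_on (\<lambda>i. e i x) {..<bundle_rank A} \<and>
              independent ((\<lambda>i. e i x) ` {..<bundle_rank A}) \<and>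
              span ((\<lambda>i. e i x) ` {..<bundle_rank A}) = fibre A x"
    using bspec[OF 2, of "(U, e)"] by simp
  show "e i x \<in> fibre A x" if a: "(U, e) \<in> frames A" "x \<in> U" and i: "i < bundle_rank A"
  proof -
    have "e i x \<in> span ((\<lambda>i. e i x) ` {..<bundle_rank A})" using i by (intro span_base) simp
    then show ?thesis using fr[OF a] by simp
  qed
  have "x \<in> (\<Union>(U, e)\<in>frames A. U)"
    by (simp only: 1 UNIV_I)
  then show "\<exists>U e. (U, e) \<in> frames A \<and> x \<in> U" by auto
qed

lemma dual_fibre_separates:
  assumes A: "vector_bundle A" and v: "v \<in> fibre A x" and 0: "\<And>\<psi>. \<psi> \<in> dual_fibre A x \<Longrightarrow> \<psi> v = 0"
  shows "v = 0"
proof -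
  obtain U e where U: "(U, e) \<in> frames A" "x \<in> U" using vector_bundleD(3)[OF A] by blast
  let ?B = "(\<lambda>i. e i x) ` {..<bundle_rank A}"
  have B: "independent ?B" "span ?B = fibre A x"
    using vector_bundleD(6)[OF A U] by auto
  have "(\<lambda>w. representation ?B w b) \<in> dual_fibre A x" for b
    unfolding dual_fibre_def lin_on_def mem_Collect_eq
  proof (intro conjI ballI allI impI)
    show "representation ?B (u + w) b = representation ?B u b + representation ?B w b"
      if "u \<in> fibre A x" "w \<in> fibre A x" for u w
      using representation_add[OF B(1)] that B(2) by (simp add: fun_eq_iff)
    show "representation ?B (c *\<^sub>R u) b = c *\<^sub>R representation ?B u b" if "u \<in> fibre A x" for u c
      using representation_scale[OF B(1)] that B(2) by (simp add: fun_eq_iff)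
    show "representation ?B w b = 0" if "w \<notin> fibre A x" for w
      using that B(2) by (simp add: representation_def)
  qed
  then have "representation ?B v b = 0" for b
    using 0 by blast
  moreover have "(\<Sum>b | representation ?B v b \<noteq> 0. representation ?B v b *\<^sub>R b) = v"
    using B v by (intro sum_nonzero_representation_eq) auto
  ultimately show ?thesis by simp
qed

lemma sectionD: "X \<in> smooth_sections A \<Longrightarrow> X x \<in> fibre A x"
  by (simp add: smooth_sections_def)

lemma section_frame:
  assumes "X \<in> smooth_sections A" "(U, e) \<in> frames A"
  shows "\<exists>c. (\<forall>i<bundle_rank A. smooth_on A U (c i)) \<and>
    (\<forall>x\<in>U. X x = (\<Sum>i<bundle_rank A. c i x *\<^sub>R e i x))"
proof -
  have "\<forall>(U, e)\<in>frames A. \<exists>c. (\<forall>i<bundle_rank A. smooth_on A U (c i)) \<and>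
       (\<forall>x\<in>U. X x = (\<Sum>i<bundle_rank A. c i x *\<^sub>R e i x))"
    using assms(1) by (simp add: smooth_sections_def)
  from bspec[OF this assms(2)] show ?thesis by (simp only: prod.case)
qed

lemma one_form_lin: "\<alpha> \<in> one_forms A \<Longrightarrow> lin_on (fibre A x) (\<alpha> x)"
  by (simp add: one_forms_def dual_fibre_def)

lemma one_form_apply_smooth:
  assumes A: "vector_bundle A" and \<alpha>: "\<alpha> \<in> one_forms A" and X: "X \<in> smooth_sections A"
  shows "(\<lambda>x. \<alpha> x (X x)) \<in> smooth_funs A"
proof (rule smooth_on_UN[OF vector_bundleD(1)[OF A], of "fst ` frames A"])
  show "open U" if "U \<in> fst ` frames A" for U
    using that vector_bundleD(4)[OF A] by auto
  show "\<Union>(fst ` frames A) = UNIV"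
    using vector_bundleD(3)[OF A] by force
  fix U assume "U \<in> fst ` frames A"
  then obtain e where U: "(U, e) \<in> frames A" by auto
  from section_frame[OF X U] obtain c where "\<forall>i<bundle_rank A. smooth_on A U (c i)"
    "\<forall>x\<in>U. X x = (\<Sum>i<bundle_rank A. c i x *\<^sub>R e i x)"
    by (elim exE conjE)
  note c = this[rule_format]
  note Uo = vector_bundleD(4)[OF A U]
  have \<alpha>e: "smooth_on A U (\<lambda>x. \<alpha> x (e i x))" if "i < bundle_rank A" for i
    using \<alpha> U that by (auto simp: one_forms_def)
  have lin: "lin_on (fibre A x) (\<alpha> x)" for x
    by (rule one_form_lin[OF \<alpha>])
  have "smooth_on A U (\<lambda>x. \<Sum>i<bundle_rank A. c i x * \<alpha> x (e i x))"
    by (intro smooth_on_sum[OF vector_bundleD(1)[OF A] Uo] smooth_on_mult[OF vector_bundleD(1)[OF A] Uo]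
        c(1) \<alpha>e)
  then show "smooth_on A U (\<lambda>x. \<alpha> x (X x))"
  proof (rule smooth_on_cong[OF vector_bundleD(1)[OF A] Uo, rotated])
    show "(\<Sum>i<bundle_rank A. c i x * \<alpha> x (e i x)) = \<alpha> x (X x)" if "x \<in> U" for x
      using lin_on_sum[OF vector_bundleD(2)[OF A] lin, where e = "\<lambda>i. e i x"]
        vector_bundleD(5)[OF A U] that c(2) by simp
  qed
qed

lemma smooth_sections_comb:
  assumes A: "vector_bundle A" and "f \<in> smooth_funs A" "g \<in> smooth_funs A"
    and X: "X \<in> smooth_sections A" and Y: "Y \<in> smooth_sections A"
  shows "(\<lambda>x. f x *\<^sub>R X x + g x *\<^sub>R Y x) \<in> smooth_sections A"
  unfolding smooth_sections_def mem_Collect_eq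
proof (intro conjI allI)
  show "f x *\<^sub>R X x + g x *\<^sub>R Y x \<in> fibre A x" for x
    by (intro subspace_add[OF vector_bundleD(2)[OF A]] subspace_scale[OF vector_bundleD(2)[OF A]]
        sectionD[OF X] sectionD[OF Y])
  show "\<forall>(U, e)\<in>frames A. \<exists>c. (\<forall>i<bundle_rank A. smooth_on A U (c i)) \<and>
       (\<forall>x\<in>U. f x *\<^sub>R X x + g x *\<^sub>R Y x = (\<Sum>i<bundle_rank A. c i x *\<^sub>R e i x))"
  proof (clarify)
    fix U e assume U: "(U, e) \<in> frames A"
    from section_frame[OF X U] obtain c where "\<forall>i<bundle_rank A. smooth_on A U (c i)"
      "\<forall>x\<in>U. X x = (\<Sum>i<bundle_rank A. c i x *\<^sub>R e i x)"
      by (elim exE conjE)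
    note c = this[rule_format]
    from section_frame[OF Y U] obtain d where "\<forall>i<bundle_rank A. smooth_on A U (d i)"
      "\<forall>x\<in>U. Y x = (\<Sum>i<bundle_rank A. d i x *\<^sub>R e i x)"
      by (elim exE conjE)
    note d = this[rule_format]
    note M = vector_bundleD(1)[OF A] and Uo = vector_bundleD(4)[OF A U]
    have fg: "smooth_on A U f" "smooth_on A U g"
      using assms(2,3) smooth_on_subset[of A UNIV _ U] by (auto simp: smooth_funs_def)
    show "\<exists>c. (\<forall>i<bundle_rank A. smooth_on A U (c i)) \<and>
       (\<forall>x\<in>U. f x *\<^sub>R X x + g x *\<^sub>R Y x = (\<Sum>i<bundle_rank A. c i x *\<^sub>R e i x))"
    proof (intro exI[of _ "\<lambda>i x. f x * c i x + g x * d i x"] conjI allI impI ballI)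
      show "smooth_on A U (\<lambda>x. f x * c i x + g x * d i x)" if "i < bundle_rank A" for i
        using that by (intro smooth_on_add[OF M Uo] smooth_on_mult[OF M Uo] fg c(1) d(1))
      show "f x *\<^sub>R X x + g x *\<^sub>R Y x = (\<Sum>i<bundle_rank A. (f x * c i x + g x * d i x) *\<^sub>R e i x)"
        if "x \<in> U" for x
        using c(2)[OF that] d(2)[OF that]
        by (simp add: scaleR_sum_right sum.distrib scaleR_add_left)
    qed
  qed
qed

lemma smooth_sections_scale:
  "vector_bundle A \<Longrightarrow> f \<in> smooth_funs A \<Longrightarrow> X \<in> smooth_sections A \<Longrightarrow>
    (\<lambda>x. f x *\<^sub>R X x) \<in> smooth_sections A"
  using smooth_sections_comb[of A f "\<lambda>x. 0" X X] by (simp add: smooth_funs_def smooth_on_const)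


subsection \<open>Decomposable bivectors\<close>

definition wedge2 :: "('m \<Rightarrow> 'v) \<Rightarrow> ('m \<Rightarrow> 'v) \<Rightarrow> 'm \<Rightarrow> ('v \<Rightarrow> real) \<Rightarrow> ('v \<Rightarrow> real) \<Rightarrow> real"
  where "wedge2 X Y x \<phi> \<psi> = \<phi> (X x) * \<psi> (Y x) - \<phi> (Y x) * \<psi> (X x)"

definition wedge3 :: "('m \<Rightarrow> 'v) \<Rightarrow> ('m \<Rightarrow> 'v) \<Rightarrow> ('m \<Rightarrow> 'v) \<Rightarrow>
    'm \<Rightarrow> ('v \<Rightarrow> real) \<Rightarrow> ('v \<Rightarrow> real) \<Rightarrow> ('v \<Rightarrow> real) \<Rightarrow> real"
  where "wedge3 X Y Z x \<phi> \<psi> \<theta> =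
      \<phi> (X x) * wedge2 Y Z x \<psi> \<theta> + \<phi> (Y x) * wedge2 Z X x \<psi> \<theta> + \<phi> (Z x) * wedge2 X Y x \<psi> \<theta>"

lemma sharp_wedge2:
  assumes A: "vector_bundle A" and X: "X x \<in> fibre A x" and Y: "Y x \<in> fibre A x"
  shows "sharp A (wedge2 X Y) x \<phi> = \<phi> (X x) *\<^sub>R Y x + (- \<phi> (Y x)) *\<^sub>R X x"
    (is "_ = ?v")
  unfolding sharp_def
proof (rule the_equality)
  have v: "?v \<in> fibre A x"
    using X Y vector_bundleD(2)[OF A] by (metis subspace_add subspace_scale)
  have lin: "lin_on (fibre A x) \<psi>" if "\<psi> \<in> dual_fibre A x" for \<psi>
    using that unfolding dual_fibre_def by blast
  have e: "\<psi> ?v = wedge2 X Y x \<phi> \<psi>" if \<psi>: "\<psi> \<in> dual_fibre A x" for \<psi>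
  proof -
    have "\<psi> ?v = \<psi> (\<phi> (X x) *\<^sub>R Y x) + \<psi> ((- \<phi> (Y x)) *\<^sub>R X x)"
      using lin[OF \<psi>] X Y vector_bundleD(2)[OF A, of x] unfolding lin_on_def
      by (metis subspace_scale)
    also have "\<dots> = \<phi> (X x) *\<^sub>R \<psi> (Y x) + (- \<phi> (Y x)) *\<^sub>R \<psi> (X x)"
      using lin[OF \<psi>] X Y unfolding lin_on_def by metis
    finally show ?thesis by (simp add: wedge2_def)
  qed
  show "?v \<in> fibre A x \<and> (\<forall>\<psi>\<in>dual_fibre A x. \<psi> ?v = wedge2 X Y x \<phi> \<psi>)"
    using v e by blast
  fix w assume w: "w \<in> fibre A x \<and> (\<forall>\<psi>\<in>dual_fibre A x. \<psi> w = wedge2 X Y x \<phi> \<psi>)"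
  have "w - ?v = 0"
  proof (rule dual_fibre_separates[OF A])
    show "w - ?v \<in> fibre A x" using v w vector_bundleD(2)[OF A] by (metis subspace_diff)
    fix \<psi> assume \<psi>: "\<psi> \<in> dual_fibre A x"
    have "\<psi> w = \<psi> ((w - ?v) + ?v)" by simp
    also have "\<dots> = \<psi> (w - ?v) + \<psi> ?v"
      using lin[OF \<psi>] \<open>w - ?v \<in> fibre A x\<close> v unfolding lin_on_def by blast
    finally have "\<psi> w = \<psi> (w - ?v) + \<psi> ?v" .
    moreover have "\<psi> w = wedge2 X Y x \<phi> \<psi>" using w \<psi> by blast
    ultimately show "\<psi> (w - ?v) = 0" using e[OF \<psi>] by linarith
  qed
  then show "w = ?v" by simp
qed

lemma lie_algebroid_vb: "lie_algebroid A \<Longrightarrow> vector_bundle A"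
  unfolding lie_algebroid_def by (rule conjunct1)

lemma lie_algebroidD:
  assumes "lie_algebroid A"
  shows "v \<in> fibre A x \<Longrightarrow> tangent_vector A x (anchor A x v)"
    and "f \<in> smooth_funs A \<Longrightarrow> lin_on (fibre A x) (\<lambda>v. anchor A x v f)"
  using assms[unfolded lie_algebroid_def, THEN conjunct2, THEN conjunct1]
    assms[unfolded lie_algebroid_def, THEN conjunct2, THEN conjunct2, THEN conjunct1] by simp_all

lemma anchor_on_comb:
  assumes A: "lie_algebroid A" and X: "X \<in> smooth_sections A" and Y: "Y \<in> smooth_sections A"
    and h: "h \<in> smooth_funs A"
  shows "anchor_on A (\<lambda>x. f x *\<^sub>R X x + g x *\<^sub>R Y x) h x = f x * anchor_on A X h x + g x * anchor_on A Y h x"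
proof -
  have l: "lin_on (fibre A x) (\<lambda>v. anchor A x v h)"
    by (rule lie_algebroidD(2)[OF A h])
  have s: "subspace (fibre A x)" using vector_bundleD(2)[OF lie_algebroid_vb[OF A]] .
  have XY: "X x \<in> fibre A x" "Y x \<in> fibre A x" using X Y unfolding smooth_sections_def by auto
  show ?thesis
    using l s XY unfolding lin_on_def anchor_on_def
    by (simp add: subspace_scale)
qed

lemma anchor_on_deriv:
  assumes A: "lie_algebroid A" and X: "X \<in> smooth_sections A"
    and f: "f \<in> smooth_funs A" and g: "g \<in> smooth_funs A"
  shows "anchor_on A X (\<lambda>y. f y + g y) x = anchor_on A X f x + anchor_on A X g x"
    and "anchor_on A X (\<lambda>y. f y * g y) x = anchor_on A X f x * g x + f x * anchor_on A X g x"
    and "anchor_on A X (\<lambda>y. - f y) x = - anchor_on A X f x"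
proof -
  have t: "tangent_vector A x (anchor A x (X x))"
    by (rule lie_algebroidD(1)[OF A sectionD[OF X]])
  show "anchor_on A X (\<lambda>y. f y + g y) x = anchor_on A X f x + anchor_on A X g x"
    "anchor_on A X (\<lambda>y. f y * g y) x = anchor_on A X f x * g x + f x * anchor_on A X g x"
    using t f g unfolding tangent_vector_def anchor_on_def by blast+
  have "anchor A x (X x) (\<lambda>y. - 1 * f y) = - 1 * anchor A x (X x) f"
    using t f unfolding tangent_vector_def by blast
  then show "anchor_on A X (\<lambda>y. - f y) x = - anchor_on A X f x"
    by (simp add: anchor_on_def)
qed

lemma bracket_rules:
  assumes A: "lie_algebroid A" and X: "X \<in> smooth_sections A" and Y: "Y \<in> smooth_sections A"
  shows "bracket A X Y \<in> smooth_sections A"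
    and "bracket A X Y x = - bracket A Y X x"
    and "f \<in> smooth_funs A \<Longrightarrow>
      bracket A X (\<lambda>x. f x *\<^sub>R Y x) x = f x *\<^sub>R bracket A X Y x + anchor_on A X f x *\<^sub>R Y x"
    and "Z \<in> smooth_sections A \<Longrightarrow>
      bracket A X (\<lambda>x. Y x + Z x) x = bracket A X Y x + bracket A X Z x"
proof -
  note d = A[unfolded lie_algebroid_def, THEN conjunct2, THEN conjunct2, THEN conjunct2, THEN conjunct2]
  note 1 = bspec[OF bspec[OF d[THEN conjunct1] X] Y]
  show "bracket A X Y \<in> smooth_sections A"
    by (rule 1[THEN conjunct1])
  show "bracket A X Y x = - bracket A Y X x"
    by (rule fun_cong[OF 1[THEN conjunct2, THEN conjunct1]])
  show "bracket A X (\<lambda>x. f x *\<^sub>R Y x) x = f x *\<^sub>R bracket A X Y x + anchor_on A X f x *\<^sub>R Y x"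
    if "f \<in> smooth_funs A"
    by (rule fun_cong[OF bspec[OF 1[THEN conjunct2, THEN conjunct2, THEN conjunct2] that]])
  show "bracket A X (\<lambda>x. Y x + Z x) x = bracket A X Y x + bracket A X Z x"
    if "Z \<in> smooth_sections A"
    by (rule fun_cong[OF bspec[OF bspec[OF bspec[OF d[THEN conjunct2] X] Y] that, THEN conjunct1]])
qed

lemma bracket_comb_right:
  assumes A: "lie_algebroid A" and X: "X \<in> smooth_sections A"
    and Y: "Y \<in> smooth_sections A" and Y': "Y' \<in> smooth_sections A"
    and h: "h \<in> smooth_funs A" and k: "k \<in> smooth_funs A"
  shows "bracket A X (\<lambda>x. h x *\<^sub>R Y x + k x *\<^sub>R Y' x) x =
    h x *\<^sub>R bracket A X Y x + anchor_on A X h x *\<^sub>R Y x +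
    (k x *\<^sub>R bracket A X Y' x + anchor_on A X k x *\<^sub>R Y' x)"
proof -
  note s = smooth_sections_scale[OF lie_algebroid_vb[OF A]]
  show ?thesis
    using bracket_rules(4)[OF A X s[OF h Y] s[OF k Y'], of x]
      bracket_rules(3)[OF A X Y h, of x] bracket_rules(3)[OF A X Y' k, of x] by simp
qed

lemma lie_derivative_comb:
  assumes A: "lie_algebroid A"
    and X: "X \<in> smooth_sections A" and X': "X' \<in> smooth_sections A"
    and Y: "Y \<in> smooth_sections A" and Y': "Y' \<in> smooth_sections A"
    and f: "f \<in> smooth_funs A" and g: "g \<in> smooth_funs A"
    and h: "h \<in> smooth_funs A" and k: "k \<in> smooth_funs A"
    and \<beta>: "\<beta> \<in> one_forms A"
  defines "b \<equiv> \<lambda>Z y. \<beta> y (Z y)"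
  shows "lie_derivative A (\<lambda>x. f x *\<^sub>R X x + g x *\<^sub>R X' x) \<beta> (\<lambda>x. h x *\<^sub>R Y x + k x *\<^sub>R Y' x) x =
    f x * h x * (anchor_on A X (b Y) x - \<beta> x (bracket A X Y x)) +
    f x * k x * (anchor_on A X (b Y') x - \<beta> x (bracket A X Y' x)) +
    g x * h x * (anchor_on A X' (b Y) x - \<beta> x (bracket A X' Y x)) +
    g x * k x * (anchor_on A X' (b Y') x - \<beta> x (bracket A X' Y' x)) +
    (h x * anchor_on A Y f x + k x * anchor_on A Y' f x) * b X x +
    (h x * anchor_on A Y g x + k x * anchor_on A Y' g x) * b X' x"
proof -
  note vb = lie_algebroid_vb[OF A]
  note M = vector_bundleD(1)[OF vb]
  let ?W = "\<lambda>x. f x *\<^sub>R X x + g x *\<^sub>R X' x"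
  let ?Z = "\<lambda>x. h x *\<^sub>R Y x + k x *\<^sub>R Y' x"
  have W: "?W \<in> smooth_sections A"
    by (rule smooth_sections_comb[OF vb f g X X'])
  have S: "subspace (fibre A x)" for x using vector_bundleD(2)[OF vb] .
  have mem: "Z x \<in> fibre A x" if "Z \<in> smooth_sections A" for Z x
    by (rule sectionD[OF that])
  have lin: "lin_on (fibre A x) (\<beta> x)" for x
    by (rule one_form_lin[OF \<beta>])
  have add: "\<beta> x (u + v) = \<beta> x u + \<beta> x v" if "u \<in> fibre A x" "v \<in> fibre A x" for u v x
    using lin that unfolding lin_on_def by blast
  have sc: "\<beta> x (c *\<^sub>R u) = c * \<beta> x u" if "u \<in> fibre A x" for u c x
    using lin that unfolding lin_on_def by simp
  note cl = subspace_add[OF S] subspace_scale[OF S] subspace_neg[OF S]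
  have mn: "\<beta> x (- u) = - \<beta> x u" if "u \<in> fibre A x" for u x
    using sc[OF that, of "- 1"] by simp
  note bs = one_form_apply_smooth[OF vb \<beta>, folded b_def]
  have bsm: "b Z \<in> smooth_funs A" if "Z \<in> smooth_sections A" for Z
    using one_form_apply_smooth[OF vb \<beta> that] by (simp add: b_def)
  have bZ: "(\<lambda>y. \<beta> y (?Z y)) = (\<lambda>y. h y * b Y y + k y * b Y' y)"
    by (simp add: fun_eq_iff b_def add sc cl mem Y Y')
  have br: "\<beta> x (bracket A V ?Z x) = h x * \<beta> x (bracket A V Y x) + anchor_on A V h x * b Y x +
      (k x * \<beta> x (bracket A V Y' x) + anchor_on A V k x * b Y' x)"
    if V: "V \<in> smooth_sections A" for V
    by (simp add: bracket_comb_right[OF A V Y Y' h k] add sc cl mem Y Y' bracket_rules(1)[OF A V] b_def)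
  have bl: "\<beta> x (bracket A ?W V x) = f x * \<beta> x (bracket A X V x) - anchor_on A V f x * b X x +
      (g x * \<beta> x (bracket A X' V x) - anchor_on A V g x * b X' x)"
    if V: "V \<in> smooth_sections A" for V
    by (simp add: bracket_rules(2)[OF A W V] bracket_comb_right[OF A V X X' f g] add sc mn cl mem X X'
        bracket_rules(1)[OF A V] bracket_rules(1)[OF A _ V] b_def
        bracket_rules(2)[OF A X V, of x] bracket_rules(2)[OF A X' V, of x] del: minus_add_distrib)
  have an: "anchor_on A ?W (\<lambda>y. h y * b Y y + k y * b Y' y) x =
     anchor_on A ?W h x * b Y x + h x * anchor_on A ?W (b Y) x +
     (anchor_on A ?W k x * b Y' x + k x * anchor_on A ?W (b Y') x)"
    by (simp add: anchor_on_deriv[OF A W] smooth_funs_mult[OF M] h k bsm Y Y')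
  show ?thesis
    unfolding lie_derivative_def bZ an br[OF W] bl[OF Y] bl[OF Y']
    by (simp add: anchor_on_comb[OF A X X'] bsm h k Y Y' algebra_simps)
qed

theorem schouten_wedge:
  assumes A: "lie_algebroid A"
    and X: "X1 \<in> smooth_sections A" "X2 \<in> smooth_sections A"
    and Y: "Y1 \<in> smooth_sections A" "Y2 \<in> smooth_sections A"
    and \<alpha>: "\<alpha> \<in> one_forms A" and \<beta>: "\<beta> \<in> one_forms A" and \<gamma>: "\<gamma> \<in> one_forms A"
  shows "schouten_bracket A (wedge2 X1 X2) (wedge2 Y1 Y2) \<alpha> \<beta> \<gamma> x =
      wedge3 (bracket A X1 Y1) X2 Y2 x (\<alpha> x) (\<beta> x) (\<gamma> x)
    - wedge3 (bracket A X1 Y2) X2 Y1 x (\<alpha> x) (\<beta> x) (\<gamma> x)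
    - wedge3 (bracket A X2 Y1) X1 Y2 x (\<alpha> x) (\<beta> x) (\<gamma> x)
    + wedge3 (bracket A X2 Y2) X1 Y1 x (\<alpha> x) (\<beta> x) (\<gamma> x)"
proof -
  note vb = lie_algebroid_vb[OF A]
  note M = vector_bundleD(1)[OF vb]
  have mem: "Z x \<in> fibre A x" if "Z \<in> smooth_sections A" for Z x
    by (rule sectionD[OF that])
  have sh: "on_sections (sharp A (wedge2 Z Z')) \<eta> =
      (\<lambda>x. \<eta> x (Z x) *\<^sub>R Z' x + (- \<eta> x (Z' x)) *\<^sub>R Z x)"
    if "Z \<in> smooth_sections A" "Z' \<in> smooth_sections A" for Z Z' \<eta>
    unfolding on_sections_def by (rule ext, rule sharp_wedge2[OF vb mem mem], fact+)
  note sm = one_form_apply_smooth[OF vb]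
  note um = smooth_funs_uminus[OF M]
  have L: "lie_derivative A (on_sections (sharp A (wedge2 Z Z')) \<mu>) \<nu>
        (on_sections (sharp A (wedge2 V V')) \<kappa>) x =
      \<mu> x (Z x) * \<kappa> x (V x) * (anchor_on A Z' (\<lambda>y. \<nu> y (V' y)) x - \<nu> x (bracket A Z' V' x))
    - \<mu> x (Z x) * \<kappa> x (V' x) * (anchor_on A Z' (\<lambda>y. \<nu> y (V y)) x - \<nu> x (bracket A Z' V x))
    - \<mu> x (Z' x) * \<kappa> x (V x) * (anchor_on A Z (\<lambda>y. \<nu> y (V' y)) x - \<nu> x (bracket A Z V' x))
    + \<mu> x (Z' x) * \<kappa> x (V' x) * (anchor_on A Z (\<lambda>y. \<nu> y (V y)) x - \<nu> x (bracket A Z V x))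
    + (\<kappa> x (V x) * anchor_on A V' (\<lambda>y. \<mu> y (Z y)) x - \<kappa> x (V' x) * anchor_on A V (\<lambda>y. \<mu> y (Z y)) x)
      * \<nu> x (Z' x)
    - (\<kappa> x (V x) * anchor_on A V' (\<lambda>y. \<mu> y (Z' y)) x - \<kappa> x (V' x) * anchor_on A V (\<lambda>y. \<mu> y (Z' y)) x)
      * \<nu> x (Z x)"
    if Z: "Z \<in> smooth_sections A" "Z' \<in> smooth_sections A"
      and V: "V \<in> smooth_sections A" "V' \<in> smooth_sections A"
      and \<mu>: "\<mu> \<in> one_forms A" and \<nu>: "\<nu> \<in> one_forms A" and \<kappa>: "\<kappa> \<in> one_forms A"
    for Z Z' V V' \<mu> \<nu> \<kappa>
    unfolding sh[OF Z] sh[OF V]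
    by (subst lie_derivative_comb[OF A Z(2,1) V(2,1) sm[OF \<mu> Z(1)] um[OF sm[OF \<mu> Z(2)]]
          sm[OF \<kappa> V(1)] um[OF sm[OF \<kappa> V(2)]] \<nu>])
       (simp add: anchor_on_deriv(3)[OF A _ sm[OF \<mu> Z(2)] sm[OF \<mu> Z(2)]] V algebra_simps)
  have sk: "\<eta> x (bracket A V Z x) = - \<eta> x (bracket A Z V x)"
    if \<eta>: "\<eta> \<in> one_forms A" and Z: "Z \<in> smooth_sections A" and V: "V \<in> smooth_sections A" for \<eta> Z V
  proof -
    have "lin_on (fibre A x) (\<eta> x)"
      by (rule one_form_lin[OF \<eta>])
    then have "\<eta> x ((- 1) *\<^sub>R bracket A Z V x) = (- 1) *\<^sub>R \<eta> x (bracket A Z V x)"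
      using mem[OF bracket_rules(1)[OF A Z V], of x] unfolding lin_on_def by blast
    then show ?thesis using bracket_rules(2)[OF A V Z, of x] by simp
  qed
  note sks = sk[OF \<alpha> X(1) Y(1)] sk[OF \<alpha> X(1) Y(2)] sk[OF \<alpha> X(2) Y(1)] sk[OF \<alpha> X(2) Y(2)]
    sk[OF \<beta> X(1) Y(1)] sk[OF \<beta> X(1) Y(2)] sk[OF \<beta> X(2) Y(1)] sk[OF \<beta> X(2) Y(2)]
    sk[OF \<gamma> X(1) Y(1)] sk[OF \<gamma> X(1) Y(2)] sk[OF \<gamma> X(2) Y(1)] sk[OF \<gamma> X(2) Y(2)]
  show ?thesis
    unfolding schouten_bracket_def schouten_cyclic_term_def wedge3_def wedge2_def[of _ _ x]
    unfolding L[OF X Y \<alpha> \<beta> \<gamma>] L[OF X Y \<beta> \<gamma> \<alpha>] L[OF X Y \<gamma> \<alpha> \<beta>]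
      L[OF Y X \<alpha> \<beta> \<gamma>] L[OF Y X \<beta> \<gamma> \<alpha>] L[OF Y X \<gamma> \<alpha> \<beta>] sks
    by (simp add: algebra_simps)
qed

end

(*
  Write N for the transition tensor N_k. By definition omega_{k-1}(N X, Y) = omega_{k+1}(X, Y), and
  N^2 = epsilon_k gives omega_{k+1}(N X, Y) = epsilon_k omega_{k-1}(X, Y). So for i = k - 1 and
  i = k + 1, i.e. for i \<noteq> k, omega = omega_i is a symplectic form for which N is self-adjoint, and
  both omega_N = omega(N _, _) and omega_{NN} = epsilon_k omega are closed. The remaining conditions
  follow from three identities, in which the 1-forms are written as flat(X):
    omega(TN(X, Y), Z) = d omega_N(NX, Y, Z) + d omega_N(X, NY, Z)
                         - d omega(NX, NY, Z) - d omega_{NN}(X, Y, Z),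
    [pi, pi](flat X, flat Y, flat Z) = 2 d omega(X, Y, Z),
    <C_{pi,N}(flat X, flat Z), Y> = 2 (d omega(X, Z, NY) - d omega_N(X, Z, Y)).
  To deduce TN = 0 from the first one, the values Z(x) of global sections have to exhaust the fibre
  at x; this needs bump functions.
*)
theory Submission
  imports Defs
begin

subsection \<open>Bump functions\<close>

text \<open>A polynomial in \<open>1 / t\<close> is allowed as a factor to make this class of functions closed under
  differentiation.\<close>

definition exp_inverse :: "real poly \<Rightarrow> real \<Rightarrow> real"
  where "exp_inverse p t = (if t > 0 then poly p (1 / t) * exp (- (1 / t)) else 0)"

text \<open>With s = 1/t this is the decay of \<open>exp_inverse p\<close> as t tends to 0 from the
  right; the exponential beats each monomial of p.\<close>

lemma poly_mult_exp_minus_tendsto_0: "((\<lambda>s. poly p s * exp (- s)) \<longlongrightarrow> (0::real)) at_top"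
proof -
  have "((\<lambda>s. s ^ i / exp s) \<longlongrightarrow> (0::real)) at_top" for i
    by (rule tendsto_power_div_exp_0)
  then have "((\<lambda>s. \<Sum>i\<le>degree p. coeff p i * (s ^ i / exp s)) \<longlongrightarrow> (\<Sum>i\<le>degree p. coeff p i * 0)) at_top"
    by (intro tendsto_sum tendsto_mult tendsto_const)
  moreover have "(\<lambda>s. \<Sum>i\<le>degree p. coeff p i * (s ^ i / exp s)) = (\<lambda>s. poly p s * exp (- s))"
    by (simp add: fun_eq_iff poly_altdef sum_distrib_right exp_minus divide_inverse mult.assoc)
  ultimately show ?thesis by simp
qed

text \<open>For t > 0 put s = 1/t, so that ds/dt = -s^2; then p(s) exp(-s) has derivative s^2 (p -
  p')(s) exp(-s), and \<open>[:0, 0, 1:]\<close> is the factor s^2. At t = 0 both one-sided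
  difference quotients tend to 0, which is the value of \<open>exp_inverse\<close> there.\<close>

lemma exp_inverse_deriv:
  "(exp_inverse p has_field_derivative exp_inverse ([:0, 0, 1:] * (p - pderiv p)) t) (at t)"
proof -
  consider "t > 0" | "t < 0" | "t = 0" by linarith
  then show ?thesis
  proof cases
    case 1
    have ev: "\<forall>\<^sub>F s in nhds t. poly p (1 / s) * exp (- (1 / s)) = exp_inverse p s"
      using eventually_nhds_in_open[OF open_greaterThan, of t 0] 1
      by (auto simp: exp_inverse_def elim!: eventually_mono)
    have "((\<lambda>s. poly p (1 / s) * exp (- (1 / s))) has_field_derivative
        exp_inverse ([:0, 0, 1:] * (p - pderiv p)) t) (at t)"
      using 1 by (auto intro!: derivative_eq_intros DERIV_chain2[OF poly_DERIV]
          simp: exp_inverse_def field_simps power2_eq_square)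
    then show ?thesis
      using DERIV_cong_ev[OF refl ev refl] by simp
  next
    case 2
    have ev: "\<forall>\<^sub>F s in nhds t. 0 = exp_inverse p s"
      using eventually_nhds_in_open[OF open_lessThan, of t 0] 2
      by (auto simp: exp_inverse_def elim!: eventually_mono)
    have "exp_inverse ([:0, 0, 1:] * (p - pderiv p)) t = 0"
      using 2 by (simp add: exp_inverse_def)
    then show ?thesis
      using DERIV_cong_ev[OF refl ev refl, of 0] by simp
  next
    case 3
    have "((\<lambda>h. exp_inverse p h / h) \<longlongrightarrow> 0) (at_right 0)"
    proof (rule Lim_transform_eventually)
      have "filterlim (\<lambda>h::real. 1 / h) at_top (at_right 0)"
        using filterlim_inverse_at_top_right by (simp add: divide_inverse)
      \<comment> \<open>The factor \<open>[:0, 1:]\<close>, that is s = 1/h, comes from dividing by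
        h in the difference quotient.\<close>
      from filterlim_compose[OF poly_mult_exp_minus_tendsto_0[of "[:0, 1:] * p"] this]
      show "((\<lambda>h. poly ([:0, 1:] * p) (1 / h) * exp (- (1 / h))) \<longlongrightarrow> 0) (at_right 0)" .
      show "\<forall>\<^sub>F h in at_right 0. poly ([:0, 1:] * p) (1 / h) * exp (- (1 / h)) = exp_inverse p h / h"
        using eventually_at_right_less[of "0::real"]
        by eventually_elim (simp add: exp_inverse_def)
    qed
    moreover have "((\<lambda>h. exp_inverse p h / h) \<longlongrightarrow> 0) (at_left 0)"
      by (rule tendsto_eventually)
        (use eventually_at_left_real[of "-1" "0::real"] in \<open>auto simp: exp_inverse_def elim!: eventually_mono\<close>)
    ultimately have "((\<lambda>h. exp_inverse p h / h) \<longlongrightarrow> 0) (at 0)"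
      by (simp add: filterlim_at_split)
    then show ?thesis
      using 3 by (simp add: DERIV_def exp_inverse_def)
  qed
qed

text \<open>By the chain rule a partial derivative is a function of the same class, with another
  polynomial, times a partial derivative of g. Hence the induction on k has p arbitrary while g
  stays fixed.\<close>

lemma C_k_on_exp_inverse:
  assumes V: "openin (Euclidean_space n) V"
  shows "C_k_on n k V g \<Longrightarrow> C_k_on n k V (\<lambda>x. exp_inverse p (g x))"
proof (induction k arbitrary: p)
  have cont: "continuous_on V (\<lambda>x. exp_inverse p (g x))" if "continuous_on V g" for p
  proof -
    have "isCont (exp_inverse p) t" for t
      by (rule DERIV_isCont[OF exp_inverse_deriv])
    then have "continuous_on UNIV (exp_inverse p)"
      by (simp add: continuous_on_eq_continuous_at)
    then show ?thesis
      using that by (rule continuous_on_compose2) simp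
  qed
  {
    case 0
    then show ?case using cont by simp
  next
    case (Suc k)
    have d: "((\<lambda>t. exp_inverse p (g (x(i := t)))) has_field_derivative
        exp_inverse ([:0, 0, 1:] * (p - pderiv p)) (g x) * partial_deriv i g x) (at (x i))"
      if "x \<in> V" "i < n" for x i
    proof -
      have "((\<lambda>t. g (x(i := t))) has_field_derivative partial_deriv i g x) (at (x i))"
        using Suc.prems that by (simp add: partial_deriv_def DERIV_deriv_iff_field_differentiable)
      from DERIV_chain2[OF exp_inverse_deriv this] show ?thesis by simp
    qed
    have "C_k_on n k V (partial_deriv i (\<lambda>x. exp_inverse p (g x)))" if i: "i < n" for i
    proof (rule C_k_on_cong[OF V])
      show "C_k_on n k V (\<lambda>x. exp_inverse ([:0, 0, 1:] * (p - pderiv p)) (g x) * partial_deriv i g x)"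
        using Suc.prems i C_k_on_SucD[OF Suc.prems] by (intro C_k_on_mult[OF V] Suc.IH) auto
      show "exp_inverse ([:0, 0, 1:] * (p - pderiv p)) (g x) * partial_deriv i g x =
          partial_deriv i (\<lambda>x. exp_inverse p (g x)) x" if "x \<in> V" for x
        unfolding partial_deriv_def[of i "\<lambda>x. exp_inverse p (g x)"]
        using DERIV_imp_deriv[OF d[OF that i]] by simp
    qed
    moreover have fd: "(\<lambda>t. exp_inverse p (g (x(i := t)))) field_differentiable at (x i)"
      if "x \<in> V" "i < n" for x i
      unfolding field_differentiable_def using d[OF that] by (rule exI)
    ultimately show ?case
      using cont Suc.prems by simp
  }
qed

lemma smooth_on_exp_inverse:
  assumes "smooth_manifold M" "open U" "smooth_on M U g"
  shows "smooth_on M U (\<lambda>x. exp_inverse p (g x))"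
  using assms(3) chart_image_open[OF assms(1) _ assms(2)]
  unfolding smooth_on_def C_inf_on_def by (fastforce intro: C_k_on_exp_inverse)

section \<open>Products, chart coordinates and gluing of smooth functions on a manifold\<close>

lemma smooth_on_prod:
  assumes "smooth_manifold M" "open U" "\<And>i. i < (r::nat) \<Longrightarrow> smooth_on M U (f i)"
  shows "smooth_on M U (\<lambda>x. \<Prod>i<r. f i x)"
  using assms(3) by (induction r) (auto intro: smooth_on_const smooth_on_mult[OF assms(1,2)])

text \<open>In a second chart the coordinate functions become components of a transition
  map.\<close>

lemma smooth_on_coordinate:
  assumes M: "smooth_manifold M" and c: "(U, \<phi>) \<in> charts M" and i: "i < mdim M"
  shows "smooth_on M U (\<lambda>x. \<phi> x i)"
  unfolding smooth_on_def
proof (clarify)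
  fix V \<psi> assume V: "(V, \<psi>) \<in> charts M"
  have "\<forall>(U, \<phi>)\<in>charts M. \<forall>(V, \<psi>)\<in>charts M. \<forall>i<mdim M.
       C_inf_on (mdim M) (\<phi> ` (U \<inter> V)) (\<lambda>y. \<psi> (inv_into U \<phi> y) i)"
    using M unfolding smooth_manifold_def by (elim conjE)
  from bspec[OF bspec[OF this V, unfolded prod.case] c] i
  show "C_inf_on (mdim M) (\<psi> ` (U \<inter> V)) (\<lambda>y. \<phi> (inv_into V \<psi> y) i)"
    by (simp add: Int_commute)
qed

lemma smooth_on_Un:
  assumes M: "smooth_manifold M" and U: "open U" "open U'"
    and f: "smooth_on M U f" "smooth_on M U' f"
  shows "smooth_on M (U \<union> U') f"
  unfolding smooth_on_def C_inf_on_def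
proof (clarify)
  fix V \<phi> k assume c: "(V, \<phi>) \<in> charts M"
  show "C_k_on (mdim M) k (\<phi> ` ((U \<union> U') \<inter> V)) (\<lambda>y. f (inv_into V \<phi> y))"
  proof (rule C_k_on_local[OF chart_image_open[OF M c open_Un[OF U]]])
    fix y assume "y \<in> \<phi> ` ((U \<union> U') \<inter> V)"
    then obtain W where W: "W = U \<or> W = U'" and y: "y \<in> \<phi> ` (W \<inter> V)" by auto
    have "openin (Euclidean_space (mdim M)) (\<phi> ` (W \<inter> V))"
      using W U by (intro chart_image_open[OF M c]) auto
    moreover have "C_k_on (mdim M) k (\<phi> ` (W \<inter> V)) (\<lambda>y. f (inv_into V \<phi> y))"
      using W f c by (auto simp: smooth_on_def C_inf_on_def)
    moreover have "\<phi> ` (W \<inter> V) \<subseteq> \<phi> ` ((U \<union> U') \<inter> V)"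
      using W by auto
    ultimately show "\<exists>W\<subseteq>\<phi> ` ((U \<union> U') \<inter> V). openin (Euclidean_space (mdim M)) W \<and> y \<in> W \<and>
        C_k_on (mdim M) k W (\<lambda>y. f (inv_into V \<phi> y))"
      using y by (intro exI[of _ "\<phi> ` (W \<inter> V)"] conjI)
  qed
qed

text \<open>U is covered by the open sets U \<inter> V and U - K: on the first the extension is f,
  on the second it is 0. Closedness of K makes the second set open, and K \<subseteq> V makes them
  cover U.\<close>

lemma smooth_on_extend_0:
  assumes M: "smooth_manifold M" and U: "open U" "open V" and f: "smooth_on M (U \<inter> V) f"
    and K: "closed K" "K \<subseteq> V" "\<And>x. x \<in> V - K \<Longrightarrow> f x = 0"
  shows "smooth_on M U (\<lambda>x. if x \<in> V then f x else 0)"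
proof -
  have "smooth_on M (U \<inter> V) (\<lambda>x. if x \<in> V then f x else 0)"
    by (rule smooth_on_cong[OF M open_Int[OF U] _ f]) auto
  moreover have "smooth_on M (U - K) (\<lambda>x. if x \<in> V then f x else 0)"
    using K by (intro smooth_on_cong[OF M open_Diff[OF U(1) K(1)] _ smooth_on_const[of _ _ 0]]) auto
  ultimately have "smooth_on M (U \<inter> V \<union> (U - K)) (\<lambda>x. if x \<in> V then f x else 0)"
    by (intro smooth_on_Un M open_Int open_Diff U K)
  then show ?thesis
    by (rule smooth_on_subset) (use K in auto)
qed

section \<open>Compact boxes in coordinate space and bump functions in a chart\<close>

text \<open>A basic neighbourhood of p in the product topology restricts the coordinates one by one.
  The coordinates from n on agree with those of p, both being 0, so only n radii have to be
  compared.\<close>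

lemma Euclidean_space_box:
  assumes V: "openin (Euclidean_space n) V" and p: "p \<in> V"
  obtains r :: real where "r > 0" "\<And>y. (\<forall>i<n. \<bar>y i - p i\<bar> \<le> r) \<Longrightarrow> (\<forall>i\<ge>n. y i = 0) \<Longrightarrow> y \<in> V"
proof -
  obtain T where T: "open T" "V = {x. \<forall>i\<ge>n. x i = 0} \<inter> T"
    using V by (auto simp: Euclidean_space_def euclidean_product_topology openin_open)
  have pT: "p \<in> T" "\<forall>i\<ge>n. p i = 0" using p T by auto
  obtain X where X: "p \<in> Pi\<^sub>E UNIV X" "\<And>i. open (X i)" "Pi\<^sub>E UNIV X \<subseteq> T"
    using product_topology_open_contains_basis[OF T(1)[unfolded open_fun_def] pT(1)] by auto
  have "\<exists>r>0. \<forall>t. \<bar>t - p i\<bar> \<le> r \<longrightarrow> t \<in> X i" for i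
  proof -
    have "p i \<in> X i" using X(1) by auto
    then obtain r where "r > 0" "cball (p i) r \<subseteq> X i"
      using X(2) open_contains_cball by blast
    then show ?thesis
      by (intro exI[of _ r]) (auto simp: dist_real_def subset_iff abs_minus_commute)
  qed
  then obtain \<rho> where \<rho>: "\<And>i. \<rho> i > 0" "\<And>i t. \<bar>t - p i\<bar> \<le> \<rho> i \<Longrightarrow> t \<in> X i"
    by metis
  \<comment> \<open>Inserting 1 keeps the minimum over a nonempty set when n = 0.\<close>
  define r where "r = Min (insert 1 (\<rho> ` {..<n}))"
  show ?thesis
  proof (rule that[of r])
    show "r > 0" unfolding r_def using \<rho>(1) by simp
    fix y assume y: "\<forall>i<n. \<bar>y i - p i\<bar> \<le> r" "\<forall>i\<ge>n. y i = 0"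
    have "y i \<in> X i" for i
    proof (cases "i < n")
      case True
      then have "r \<le> \<rho> i" unfolding r_def by simp
      then show ?thesis using y True \<rho>(2) by force
    next
      case False
      then show ?thesis using y(2) pT(2) \<rho>(2)[of "p i" i] less_imp_le[OF \<rho>(1)[of i]] by auto
    qed
    then show "y \<in> V" using X(3) y(2) T(2) by auto
  qed
qed

text \<open>Tychonoff: the box is a product of closed intervals in the first n coordinates and of
  singletons {0} in the others.\<close>

lemma compact_Euclidean_box:
  "compact {y::nat \<Rightarrow> real. (\<forall>i<n. \<bar>y i - p i\<bar> \<le> r) \<and> (\<forall>i\<ge>n. y i = 0)}"
proof -
  have "{y. (\<forall>i<n. \<bar>y i - p i\<bar> \<le> r) \<and> (\<forall>i\<ge>n. y i = 0)} =
      Pi\<^sub>E UNIV (\<lambda>i. if i < n then cball (p i) r else {0})"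
    by (auto simp: PiE_iff dist_real_def abs_minus_commute split: if_splits)
  moreover have "compactin (product_topology (\<lambda>i. euclidean) UNIV)
      (Pi\<^sub>E UNIV (\<lambda>i. if i < n then cball (p i) r else {0}))"
    by (subst compactin_PiE) auto
  ultimately show ?thesis
    by (simp add: euclidean_product_topology)
qed

text \<open>In a chart at x, with t_i the coordinates centred at x, the product of the functions
  exp(-1/(r^2 - t_i^2)), each replaced by 0 where |t_i| \<ge> r, vanishes outside a closed box lying
  in the image of W. It is extended by 0 from the chart domain to the manifold.\<close>

lemma bump_function:
  fixes M :: "('m::{t2_space,second_countable_topology}, 'z) manifold_scheme"
  assumes M: "smooth_manifold M" and W: "open W" and x: "x \<in> W"
  obtains f K where "f \<in> smooth_funs M" "f x \<noteq> 0" "closed K" "K \<subseteq> W" "\<And>y. y \<notin> K \<Longrightarrow> f y = 0"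
proof -
  have "x \<in> (\<Union>(U, \<phi>)\<in>charts M. U)" using M unfolding smooth_manifold_def by simp
  then obtain U \<phi> where c: "(U, \<phi>) \<in> charts M" and xU: "x \<in> U" by auto
  let ?n = "mdim M"
  have U: "open U" and hom: "homeomorphic_map (top_of_set U) (subtopology (Euclidean_space ?n) (\<phi> ` U)) \<phi>"
    and im: "openin (Euclidean_space ?n) (\<phi> ` U)"
    using M c unfolding smooth_manifold_def by auto
  have eu: "Euclidean_space ?n = top_of_set {x. \<forall>i\<ge>?n. x i = 0}"
    by (simp add: Euclidean_space_def euclidean_product_topology)
  have zero: "\<phi> y i = 0" if "y \<in> U" "i \<ge> ?n" for y i
    using openin_subset[OF im] that by (auto simp: eu)
  obtain r where r: "r > 0"
    "\<And>y. (\<forall>i<?n. \<bar>y i - \<phi> x i\<bar> \<le> r) \<Longrightarrow> (\<forall>i\<ge>?n. y i = 0) \<Longrightarrow> y \<in> \<phi> ` (W \<inter> U)"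
    using Euclidean_space_box[OF chart_image_open[OF M c W], of "\<phi> x"] x xU by blast
  define B where "B = {y. (\<forall>i<?n. \<bar>y i - \<phi> x i\<bar> \<le> r) \<and> (\<forall>i\<ge>?n. y i = 0)}"
  define K where "K = {y \<in> U. \<phi> y \<in> B}"
  have inj: "inj_on \<phi> U" by (rule chart_inj[OF M c])
  have BW: "B \<subseteq> \<phi> ` (W \<inter> U)" using r(2) by (auto simp: B_def)
  have KW: "K \<subseteq> W"
  proof
    fix y assume "y \<in> K"
    then obtain z where "z \<in> W \<inter> U" "\<phi> y = \<phi> z" "y \<in> U" using BW unfolding K_def by blast
    then show "y \<in> W" using inj by (auto dest: inj_onD)
  qed
  obtain \<psi> where \<psi>: "homeomorphic_maps (top_of_set U) (subtopology (Euclidean_space ?n) (\<phi> ` U)) \<phi> \<psi>"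
    using hom by (auto simp: homeomorphic_map_maps)
  \<comment> \<open>K is written as a continuous image of the box, under the inverse of the chart,
    to obtain its compactness.\<close>
  have "K = \<psi> ` B"
    using \<psi> BW openin_subset[OF im] by (force simp: homeomorphic_maps_def K_def eu)
  moreover have "continuous_on B \<psi>"
  proof -
    have "continuous_map (subtopology (Euclidean_space ?n) (\<phi> ` U)) (top_of_set U) \<psi>"
      using \<psi> by (simp add: homeomorphic_maps_def)
    then have "continuous_on ({x. \<forall>i\<ge>?n. x i = 0} \<inter> \<phi> ` U) \<psi>"
      by (simp add: eu subtopology_subtopology continuous_map_in_subtopology)
    then show ?thesis by (rule continuous_on_subset) (use BW in \<open>auto simp: B_def\<close>)
  qed
  ultimately have "compact K"
    using compact_continuous_image[OF _ compact_Euclidean_box[of ?n "\<phi> x" r, folded B_def]] by simp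
  \<comment> \<open>Being closed in U would not suffice for extending by 0; compactness in the
    Hausdorff space of all points makes K closed globally.\<close>
  then have K: "closed K" by (rule compact_imp_closed)
  \<comment> \<open>The polynomial 1 gives exp(-1/t). The difference is spelled with
    \<open>+\<close> and \<open>- 1 *\<close> to match the closure rules for sums, products and
    constants.\<close>
  define g where "g y = (\<Prod>i<?n. exp_inverse 1 (r\<^sup>2 + - 1 * ((\<phi> y i + - \<phi> x i) * (\<phi> y i + - \<phi> x i))))" for y
  have g: "smooth_on M U g"
    unfolding g_def
    by (intro smooth_on_prod smooth_on_exp_inverse smooth_on_add smooth_on_mult smooth_on_const
        smooth_on_coordinate[OF M c] M U)
  have g0: "g y = 0" if y: "y \<in> U - K" for y
  proof -
    obtain i where i: "i < ?n" "r < \<bar>\<phi> y i - \<phi> x i\<bar>"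
      using y zero by (force simp: K_def B_def)
    have "r\<^sup>2 \<le> (\<phi> y i - \<phi> x i)\<^sup>2"
      using power_mono[of r "\<bar>\<phi> y i - \<phi> x i\<bar>" 2] i r(1) by simp
    then show ?thesis
      unfolding g_def using i(1)
      by (intro prod_zero) (auto simp: exp_inverse_def power2_eq_square intro!: bexI[of _ i])
  qed
  show ?thesis
  proof (rule that)
    show "(\<lambda>y. if y \<in> U then g y else 0) \<in> smooth_funs M"
      unfolding smooth_funs_def mem_Collect_eq
      by (rule smooth_on_extend_0[OF M open_UNIV U _ K]) (use g g0 in \<open>auto simp: K_def\<close>)
    show "(if x \<in> U then g x else 0) \<noteq> 0"
      using xU r(1) by (simp add: g_def exp_inverse_def)
    show "(if y \<in> U then g y else 0) = 0" if "y \<notin> K" for y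
      using that g0 by auto
  qed (use K KW in auto)
qed

subsection \<open>Sections with a prescribed value at a point\<close>

text \<open>The frame vector field is multiplied by a bump function supported in U, extended by 0,
  and finally divided by the constant f(x).\<close>

lemma section_through_frame_vector:
  fixes A :: "('m::{t2_space,second_countable_topology}, 'v::real_vector, 'z) vector_bundle_scheme"
  assumes A: "vector_bundle A" and U: "(U, e) \<in> frames A" and x: "x \<in> U" and j: "j < bundle_rank A"
  shows "\<exists>Z\<in>smooth_sections A. Z x = e j x"
proof -
  note M = vector_bundleD(1)[OF A]
  note Uo = vector_bundleD(4)[OF A U]
  obtain f K where f: "f \<in> smooth_funs A" "f x \<noteq> 0" "closed K" "K \<subseteq> U" "\<And>y. y \<notin> K \<Longrightarrow> f y = 0"
    by (rule bump_function[OF M Uo x]) blast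
  define Z where "Z y = (if y \<in> U then f y *\<^sub>R e j y else 0)" for y
  have "Z \<in> smooth_sections A"
    unfolding smooth_sections_def mem_Collect_eq
  proof (intro conjI allI)
    show "Z y \<in> fibre A y" for y
      using subspace_scale[OF vector_bundleD(2)[OF A] vector_bundleD(5)[OF A U _ j]]
        subspace_0[OF vector_bundleD(2)[OF A]]
      by (simp add: Z_def)
    show "\<forall>(V, b)\<in>frames A. \<exists>c. (\<forall>i<bundle_rank A. smooth_on A V (c i)) \<and>
       (\<forall>y\<in>V. Z y = (\<Sum>i<bundle_rank A. c i y *\<^sub>R b i y))"
    proof (clarify)
      fix V b assume V: "(V, b) \<in> frames A"
      note Vo = vector_bundleD(4)[OF A V]
      have "\<forall>(U, e)\<in>frames A. \<forall>(V, e')\<in>frames A. \<forall>j<bundle_rank A.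
       \<exists>c. (\<forall>i<bundle_rank A. smooth_on A (U \<inter> V) (c i)) \<and>
           (\<forall>x\<in>U \<inter> V. e' j x = (\<Sum>i<bundle_rank A. c i x *\<^sub>R e i x))"
        using A unfolding vector_bundle_def by (elim conjE)
      from bspec[OF bspec[OF this V, unfolded prod.case] U, unfolded prod.case, rule_format, OF j]
      obtain c where "\<forall>i<bundle_rank A. smooth_on A (V \<inter> U) (c i)"
        "\<forall>y\<in>V \<inter> U. e j y = (\<Sum>i<bundle_rank A. c i y *\<^sub>R b i y)"
        by (elim exE conjE)
      note c = this[rule_format]
      have fV: "smooth_on A (V \<inter> U) f"
        using f(1) smooth_on_subset[of A UNIV f] by (auto simp: smooth_funs_def)
      show "\<exists>c. (\<forall>i<bundle_rank A. smooth_on A V (c i)) \<and>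
          (\<forall>y\<in>V. Z y = (\<Sum>i<bundle_rank A. c i y *\<^sub>R b i y))"
      \<comment> \<open>The transition functions from e to b are smooth on V \<inter> U only. Their
        products with f vanish off K, hence extend smoothly by 0 to V.\<close>
      proof (intro exI[of _ "\<lambda>i y. if y \<in> U then f y * c i y else 0"] conjI allI impI ballI)
        show "smooth_on A V (\<lambda>y. if y \<in> U then f y * c i y else 0)" if "i < bundle_rank A" for i
          by (rule smooth_on_extend_0[OF M Vo Uo smooth_on_mult[OF M open_Int[OF Vo Uo] fV c(1)[OF that]] f(3,4)])
            (simp add: f(5))
        show "Z y = (\<Sum>i<bundle_rank A. (if y \<in> U then f y * c i y else 0) *\<^sub>R b i y)" if "y \<in> V" for y
          using that c(2)[of y] by (simp add: Z_def scaleR_sum_right)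
      qed
    qed
  qed
  then have "(\<lambda>y. (1 / f x) *\<^sub>R Z y) \<in> smooth_sections A"
    by (intro smooth_sections_scale[OF A]) (simp_all add: smooth_funs_def smooth_on_const)
  moreover have "(1 / f x) *\<^sub>R Z x = e j x" using x f(2) by (simp add: Z_def)
  ultimately show ?thesis by (rule bexI[where x = "\<lambda>y. (1 / f x) *\<^sub>R Z y", rotated])
qed

text \<open>The values at x of global sections form a subspace; it contains a frame at x, hence the
  fibre spanned by the frame.\<close>

lemma section_through:
  fixes A :: "('m::{t2_space,second_countable_topology}, 'v::real_vector, 'z) vector_bundle_scheme"
  assumes A: "vector_bundle A" and v: "v \<in> fibre A x"
  obtains Z where "Z \<in> smooth_sections A" "Z x = v"
proof -
  obtain U e where U: "(U, e) \<in> frames A" "x \<in> U" using vector_bundleD(3)[OF A] by blast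
  let ?S = "(\<lambda>Z. Z x) ` smooth_sections A"
  have base: "(\<lambda>i. e i x) ` {..<bundle_rank A} \<subseteq> ?S"
  proof clarify
    fix j assume "j < bundle_rank A"
    from section_through_frame_vector[OF A U this] obtain Z where "Z \<in> smooth_sections A" "Z x = e j x"
      by (elim bexE)
    then show "e j x \<in> ?S" by (intro image_eqI[of _ _ Z]) simp_all
  qed
  have zero: "(\<lambda>x. 0) \<in> smooth_sections A"
    unfolding smooth_sections_def using vector_bundleD(2)[OF A]
    by (simp add: subspace_0 split_beta exI[of _ "\<lambda>i x. 0"] smooth_on_const)
  have c: "(\<lambda>x. c) \<in> smooth_funs A" for c by (simp add: smooth_funs_def smooth_on_const)
  have "subspace ?S"
  proof (rule subspaceI)
    show "0 \<in> ?S" using zero by (intro image_eqI) simp_all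
    show "u + w \<in> ?S" if "u \<in> ?S" "w \<in> ?S" for u w
    proof -
      obtain X Y where "X \<in> smooth_sections A" "Y \<in> smooth_sections A" "u = X x" "w = Y x"
        using \<open>u \<in> ?S\<close> \<open>w \<in> ?S\<close> by (elim imageE) simp
      then show ?thesis
        using smooth_sections_comb[OF A c[of 1] c[of 1], of X Y] by (intro image_eqI[where x = "\<lambda>x. X x + Y x"]) simp_all
    qed
    show "a *\<^sub>R u \<in> ?S" if "u \<in> ?S" for a u
    proof -
      obtain X where "X \<in> smooth_sections A" "u = X x"
        using \<open>u \<in> ?S\<close> by (elim imageE)
      then show ?thesis
        using smooth_sections_scale[OF A c[of a], of X] by (intro image_eqI[where x = "\<lambda>x. a *\<^sub>R X x"]) simp_all
    qed
  qed
  then have "span ((\<lambda>i. e i x) ` {..<bundle_rank A}) \<subseteq> ?S"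
    by (rule span_minimal[OF base])
  then have "v \<in> ?S"
    by (rule subsetD) (use v vector_bundleD(6)[OF A U] in simp)
  then show ?thesis
    by (elim imageE) (rule that, simp_all)
qed

subsection \<open>Smoothness of the musical maps\<close>

lemma coframe_props:
  assumes A: "vector_bundle A" and U: "(U, e) \<in> frames A" "x \<in> U"
  shows "coframe A e i x \<in> dual_fibre A x"
    and "v \<in> fibre A x \<Longrightarrow> (\<Sum>i<bundle_rank A. coframe A e i x v *\<^sub>R e i x) = v"
proof -
  let ?B = "(\<lambda>i. e i x) ` {..<bundle_rank A}"
  have B: "inj_on (\<lambda>i. e i x) {..<bundle_rank A}" "independent ?B" "span ?B = fibre A x"
    using vector_bundleD(6)[OF A U] by simp_all
  show "coframe A e i x \<in> dual_fibre A x"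
    unfolding dual_fibre_def lin_on_def mem_Collect_eq coframe_def
  proof (intro conjI ballI allI impI)
    show "representation ?B (u + w) (e i x) = representation ?B u (e i x) + representation ?B w (e i x)"
      if "u \<in> fibre A x" "w \<in> fibre A x" for u w
      using representation_add[OF B(2)] that B(3) by (simp add: fun_eq_iff)
    show "representation ?B (c *\<^sub>R u) (e i x) = c *\<^sub>R representation ?B u (e i x)" if "u \<in> fibre A x" for u c
      using representation_scale[OF B(2)] that B(3) by (simp add: fun_eq_iff)
    show "representation ?B w (e i x) = 0" if "w \<notin> fibre A x" for w
      using that B(3) by (simp add: representation_def)
  qed
  show "(\<Sum>i<bundle_rank A. coframe A e i x v *\<^sub>R e i x) = v" if "v \<in> fibre A x"
  proof -
    have "(\<Sum>b\<in>?B. representation ?B v b *\<^sub>R b) = v"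
      using B that by (intro sum_representation_eq) auto
    then show ?thesis
      by (simp add: sum.reindex[OF B(1)] coframe_def)
  qed
qed

lemma dual_fibreD:
  assumes "\<phi> \<in> dual_fibre A x"
  shows "lin_on (fibre A x) \<phi>" and "v \<notin> fibre A x \<Longrightarrow> \<phi> v = 0"
  using assms by (simp_all add: dual_fibre_def)

lemma dual_fibre_comb:
  assumes "\<phi> \<in> dual_fibre A x" "\<psi> \<in> dual_fibre A x"
  shows "(\<lambda>v. c * \<phi> v) \<in> dual_fibre A x" and "(\<lambda>v. \<phi> v + \<psi> v) \<in> dual_fibre A x"
  using assms by (auto simp: dual_fibre_def lin_on_def algebra_simps)

lemma dual_fibre_zero: "(\<lambda>v. 0) \<in> dual_fibre A x"
  by (simp add: dual_fibre_def lin_on_def)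

lemma dual_fibre_eqI:
  assumes "\<phi> \<in> dual_fibre A x" "\<psi> \<in> dual_fibre A x" "\<And>v. v \<in> fibre A x \<Longrightarrow> \<phi> v = \<psi> v"
  shows "\<phi> = \<psi>"
proof
  show "\<phi> v = \<psi> v" for v
    using assms by (cases "v \<in> fibre A x") (simp_all add: dual_fibreD(2))
qed

text \<open>Expand \<phi> in the dual frame as the sum of \<phi>(e_i) times the i-th coframe element
  and apply F. This is used for a bivector with one argument fixed, and takes the place of an appeal
  to the bidual.\<close>

lemma dual_functional_expand:
  fixes F :: "('v::real_vector \<Rightarrow> real) \<Rightarrow> real"
  assumes A: "vector_bundle A" and U: "(U, e) \<in> frames A" "x \<in> U"
    and add: "\<And>\<phi> \<psi>. \<phi> \<in> dual_fibre A x \<Longrightarrow> \<psi> \<in> dual_fibre A x \<Longrightarrow> F (\<lambda>v. \<phi> v + \<psi> v) = F \<phi> + F \<psi>"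
    and scale: "\<And>\<phi> c. \<phi> \<in> dual_fibre A x \<Longrightarrow> F (\<lambda>v. c * \<phi> v) = c * F \<phi>"
    and \<phi>: "\<phi> \<in> dual_fibre A x"
  shows "F \<phi> = (\<Sum>i<bundle_rank A. \<phi> (e i x) * F (coframe A e i x))"
proof -
  note \<epsilon> = coframe_props(1)[OF A U]
  \<comment> \<open>F is linear only on the dual fibre, so the induction carries membership of the
    partial sums along with the formula.\<close>
  have *: "(\<lambda>v. \<Sum>i<r. c i * coframe A e i x v) \<in> dual_fibre A x \<and>
      F (\<lambda>v. \<Sum>i<r. c i * coframe A e i x v) = (\<Sum>i<r. c i * F (coframe A e i x))"
    for c and r :: nat
  proof (induction r)
    case 0
    then show ?case using scale[OF dual_fibre_zero, of 0] by (simp add: dual_fibre_zero)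
  next
    case (Suc r)
    note s = dual_fibre_comb(1)[OF \<epsilon> \<epsilon>, of "c r" r]
    show ?case
      using dual_fibre_comb(2)[OF Suc[THEN conjunct1] s] add[OF Suc[THEN conjunct1] s]
        scale[OF \<epsilon>, of "c r" r] Suc by simp
  qed
  have "\<phi> = (\<lambda>v. \<Sum>i<bundle_rank A. \<phi> (e i x) * coframe A e i x v)"
  proof (rule dual_fibre_eqI[OF \<phi> *[THEN conjunct1]])
    fix v assume v: "v \<in> fibre A x"
    have "\<phi> (\<Sum>i<bundle_rank A. coframe A e i x v *\<^sub>R e i x) =
        (\<Sum>i<bundle_rank A. coframe A e i x v *\<^sub>R \<phi> (e i x))"
      using vector_bundleD(5)[OF A U]
      by (intro lin_on_sum[OF vector_bundleD(2)[OF A] dual_fibreD(1)[OF \<phi>]])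
    then show "\<phi> v = (\<Sum>i<bundle_rank A. \<phi> (e i x) * coframe A e i x v)"
      using coframe_props(2)[OF A U v] by (simp add: mult.commute)
  qed
  then show ?thesis
    using *[of "\<lambda>i. \<phi> (e i x)" "bundle_rank A"] by simp
qed

section \<open>Bivectors and the sharp map\<close>

lemma bivectorD:
  assumes "\<pi> \<in> bivectors A" "\<phi> \<in> dual_fibre A x" "\<psi> \<in> dual_fibre A x" "\<theta> \<in> dual_fibre A x"
  shows "\<pi> x (\<lambda>v. \<phi> v + \<psi> v) \<theta> = \<pi> x \<phi> \<theta> + \<pi> x \<psi> \<theta>"
    and "\<pi> x \<theta> (\<lambda>v. \<phi> v + \<psi> v) = \<pi> x \<theta> \<phi> + \<pi> x \<theta> \<psi>"
    and "\<pi> x (\<lambda>v. c * \<phi> v) \<theta> = c * \<pi> x \<phi> \<theta>"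
    and "\<pi> x \<theta> (\<lambda>v. c * \<phi> v) = c * \<pi> x \<theta> \<phi>"
proof -
  have "\<forall>x. \<forall>\<phi>\<in>dual_fibre A x. \<forall>\<psi>\<in>dual_fibre A x. \<forall>\<theta>\<in>dual_fibre A x. \<forall>c.
       \<pi> x (\<lambda>v. \<phi> v + \<psi> v) \<theta> = \<pi> x \<phi> \<theta> + \<pi> x \<psi> \<theta> \<and>
       \<pi> x \<theta> (\<lambda>v. \<phi> v + \<psi> v) = \<pi> x \<theta> \<phi> + \<pi> x \<theta> \<psi> \<and>
       \<pi> x (\<lambda>v. c * \<phi> v) \<theta> = c * \<pi> x \<phi> \<theta> \<and>
       \<pi> x \<theta> (\<lambda>v. c * \<phi> v) = c * \<pi> x \<theta> \<phi> \<and>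
       \<pi> x \<phi> \<phi> = 0"
    using assms(1) unfolding bivectors_def mem_Collect_eq by (rule conjunct1)
  note * = this[rule_format, OF assms(2-4), of c]
  show "\<pi> x (\<lambda>v. \<phi> v + \<psi> v) \<theta> = \<pi> x \<phi> \<theta> + \<pi> x \<psi> \<theta>"
    "\<pi> x \<theta> (\<lambda>v. \<phi> v + \<psi> v) = \<pi> x \<theta> \<phi> + \<pi> x \<theta> \<psi>"
    "\<pi> x (\<lambda>v. c * \<phi> v) \<theta> = c * \<pi> x \<phi> \<theta>"
    "\<pi> x \<theta> (\<lambda>v. c * \<phi> v) = c * \<pi> x \<theta> \<phi>"
    using * by simp_all
qed

lemma bivector_smooth:
  assumes "\<pi> \<in> bivectors A" "(U, e) \<in> frames A" "i < bundle_rank A" "j < bundle_rank A"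
  shows "smooth_on A U (\<lambda>x. \<pi> x (coframe A e i x) (coframe A e j x))"
proof -
  have "\<forall>(U, e)\<in>frames A. \<forall>i<bundle_rank A. \<forall>j<bundle_rank A.
       smooth_on A U (\<lambda>x. \<pi> x (coframe A e i x) (coframe A e j x))"
    using assms(1) unfolding bivectors_def mem_Collect_eq by (rule conjunct2)
  from bspec[OF this assms(2)] show ?thesis using assms(3,4) by simp
qed

text \<open>This resolves the definite description in \<open>sharp\<close>: the explicit sum
  satisfies its condition by \<open>dual_functional_expand\<close>, and the solution is unique
  because covectors separate the vectors of the fibre.\<close>

lemma sharp_eq_frame_sum:
  assumes A: "vector_bundle A" and U: "(U, e) \<in> frames A" "x \<in> U"
    and \<pi>: "\<pi> \<in> bivectors A" and \<phi>: "\<phi> \<in> dual_fibre A x"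
  shows "sharp A \<pi> x \<phi> = (\<Sum>j<bundle_rank A. \<pi> x \<phi> (coframe A e j x) *\<^sub>R e j x)" (is "_ = ?v")
    and "sharp A \<pi> x \<phi> \<in> fibre A x"
    and "\<psi> \<in> dual_fibre A x \<Longrightarrow> \<psi> (sharp A \<pi> x \<phi>) = \<pi> x \<phi> \<psi>"
proof -
  note S = vector_bundleD(2)[OF A] and ef = vector_bundleD(5)[OF A U]
  have v: "?v \<in> fibre A x"
    by (intro subspace_sum[OF S] subspace_scale[OF S]) (simp add: ef)
  have app: "\<psi> ?v = \<pi> x \<phi> \<psi>" if \<psi>: "\<psi> \<in> dual_fibre A x" for \<psi>
  proof -
    have "\<psi> ?v = (\<Sum>j<bundle_rank A. \<pi> x \<phi> (coframe A e j x) *\<^sub>R \<psi> (e j x))"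
      by (rule lin_on_sum[OF S dual_fibreD(1)[OF \<psi>] ef])
    also have "\<dots> = (\<Sum>j<bundle_rank A. \<psi> (e j x) * \<pi> x \<phi> (coframe A e j x))"
      by (simp add: mult.commute)
    also have "\<dots> = \<pi> x \<phi> \<psi>"
    proof (rule dual_functional_expand[OF A U _ _ \<psi>, symmetric])
      show "\<pi> x \<phi> (\<lambda>v. \<psi> v + \<theta> v) = \<pi> x \<phi> \<psi> + \<pi> x \<phi> \<theta>"
        if "\<psi> \<in> dual_fibre A x" "\<theta> \<in> dual_fibre A x" for \<psi> \<theta>
        by (rule bivectorD(2)[OF \<pi> that \<phi>])
      show "\<pi> x \<phi> (\<lambda>v. c * \<psi> v) = c * \<pi> x \<phi> \<psi>" if "\<psi> \<in> dual_fibre A x" for \<psi> c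
        by (rule bivectorD(4)[OF \<pi> that \<phi> \<phi>])
    qed
    finally show ?thesis .
  qed
  show eq: "sharp A \<pi> x \<phi> = ?v"
    unfolding sharp_def
  proof (rule the_equality)
    show "?v \<in> fibre A x \<and> (\<forall>\<psi>\<in>dual_fibre A x. \<psi> ?v = \<pi> x \<phi> \<psi>)"
      using v app by simp
    fix w assume w: "w \<in> fibre A x \<and> (\<forall>\<psi>\<in>dual_fibre A x. \<psi> w = \<pi> x \<phi> \<psi>)"
    have "w - ?v = 0"
    proof (rule dual_fibre_separates[OF A])
      show d: "w - ?v \<in> fibre A x" using w v by (simp add: subspace_diff[OF S])
      fix \<psi> assume \<psi>: "\<psi> \<in> dual_fibre A x"
      have "\<psi> ((w - ?v) + ?v) = \<psi> (w - ?v) + \<psi> ?v"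
        using dual_fibreD(1)[OF \<psi>] d v unfolding lin_on_def by blast
      then show "\<psi> (w - ?v) = 0" using w \<psi> app[OF \<psi>] by simp
    qed
    then show "w = ?v" by simp
  qed
  show "sharp A \<pi> x \<phi> \<in> fibre A x" using v eq by simp
  show "\<psi> (sharp A \<pi> x \<phi>) = \<pi> x \<phi> \<psi>" if "\<psi> \<in> dual_fibre A x" using app[OF that] eq by simp
qed

lemma sharp_props:
  assumes A: "vector_bundle A" and \<pi>: "\<pi> \<in> bivectors A" and \<phi>: "\<phi> \<in> dual_fibre A x"
  shows "sharp A \<pi> x \<phi> \<in> fibre A x"
    and "\<psi> \<in> dual_fibre A x \<Longrightarrow> \<psi> (sharp A \<pi> x \<phi>) = \<pi> x \<phi> \<psi>"
    and "\<psi> \<in> dual_fibre A x \<Longrightarrow> sharp A \<pi> x (\<lambda>v. \<phi> v + \<psi> v) = sharp A \<pi> x \<phi> + sharp A \<pi> x \<psi>"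
    and "sharp A \<pi> x (\<lambda>v. c * \<phi> v) = c *\<^sub>R sharp A \<pi> x \<phi>"
proof -
  obtain U e where U: "(U, e) \<in> frames A" "x \<in> U" using vector_bundleD(3)[OF A] by blast
  note s = sharp_eq_frame_sum[OF A U \<pi>] and \<epsilon> = coframe_props(1)[OF A U]
  show "sharp A \<pi> x \<phi> \<in> fibre A x"
    by (rule s(2)[OF \<phi>])
  show "\<psi> (sharp A \<pi> x \<phi>) = \<pi> x \<phi> \<psi>" if "\<psi> \<in> dual_fibre A x"
    by (rule s(3)[OF \<phi> that])
  show "sharp A \<pi> x (\<lambda>v. \<phi> v + \<psi> v) = sharp A \<pi> x \<phi> + sharp A \<pi> x \<psi>" if \<psi>: "\<psi> \<in> dual_fibre A x"
    by (simp add: s(1)[OF \<phi>] s(1)[OF \<psi>] s(1)[OF dual_fibre_comb(2)[OF \<phi> \<psi>]]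
        bivectorD(1)[OF \<pi> \<phi> \<psi> \<epsilon>] scaleR_add_left sum.distrib)
  show "sharp A \<pi> x (\<lambda>v. c * \<phi> v) = c *\<^sub>R sharp A \<pi> x \<phi>"
    by (simp add: s(1)[OF \<phi>] s(1)[OF dual_fibre_comb(1)[OF \<phi> \<phi>]]
        bivectorD(3)[OF \<pi> \<phi> \<phi> \<epsilon>] scaleR_sum_right)
qed

lemma one_form_dual: "\<alpha> \<in> one_forms A \<Longrightarrow> \<alpha> x \<in> dual_fibre A x"
  by (simp add: one_forms_def)

text \<open>The j-th component is \<pi>(\<phi>, \<epsilon>_j) = \<Sum> \<phi>(e_i)
  \<pi>(\<epsilon>_i, \<epsilon>_j), with \<epsilon> the dual frame of e. The family \<phi> lives on
  the domain of one frame, so that both global 1-forms and the flats of the local fields e_j are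
  covered.\<close>

lemma sharp_frame_smooth:
  assumes A: "vector_bundle A" and U: "(U, e) \<in> frames A" and \<pi>: "\<pi> \<in> bivectors A"
    and \<phi>: "\<And>x. x \<in> U \<Longrightarrow> \<phi> x \<in> dual_fibre A x"
    and sm: "\<And>i. i < bundle_rank A \<Longrightarrow> smooth_on A U (\<lambda>x. \<phi> x (e i x))"
  shows "\<exists>c. (\<forall>j<bundle_rank A. smooth_on A U (c j)) \<and>
    (\<forall>x\<in>U. sharp A \<pi> x (\<phi> x) = (\<Sum>j<bundle_rank A. c j x *\<^sub>R e j x))"
proof (intro exI[of _ "\<lambda>j x. \<pi> x (\<phi> x) (coframe A e j x)"] conjI allI impI ballI)
  note M = vector_bundleD(1)[OF A] and Uo = vector_bundleD(4)[OF A U]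
  show "sharp A \<pi> x (\<phi> x) = (\<Sum>j<bundle_rank A. \<pi> x (\<phi> x) (coframe A e j x) *\<^sub>R e j x)" if "x \<in> U" for x
    by (rule sharp_eq_frame_sum(1)[OF A U that \<pi> \<phi>[OF that]])
  fix j assume j: "j < bundle_rank A"
  have "smooth_on A U (\<lambda>x. \<Sum>i<bundle_rank A. \<phi> x (e i x) * \<pi> x (coframe A e i x) (coframe A e j x))"
    by (intro smooth_on_sum[OF M Uo] smooth_on_mult[OF M Uo] sm bivector_smooth[OF \<pi> U] j)
  then show "smooth_on A U (\<lambda>x. \<pi> x (\<phi> x) (coframe A e j x))"
  proof (rule smooth_on_cong[OF M Uo, rotated])
    fix x assume x: "x \<in> U"
    note \<epsilon> = coframe_props(1)[OF A U x]
    show "(\<Sum>i<bundle_rank A. \<phi> x (e i x) * \<pi> x (coframe A e i x) (coframe A e j x)) =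
        \<pi> x (\<phi> x) (coframe A e j x)"
    proof (rule dual_functional_expand[OF A U x _ _ \<phi>[OF x], symmetric])
      show "\<pi> x (\<lambda>v. \<psi> v + \<theta> v) (coframe A e j x) =
          \<pi> x \<psi> (coframe A e j x) + \<pi> x \<theta> (coframe A e j x)"
        if "\<psi> \<in> dual_fibre A x" "\<theta> \<in> dual_fibre A x" for \<psi> \<theta>
        by (rule bivectorD(1)[OF \<pi> that \<epsilon>])
      show "\<pi> x (\<lambda>v. c * \<psi> v) (coframe A e j x) = c * \<pi> x \<psi> (coframe A e j x)"
        if "\<psi> \<in> dual_fibre A x" for \<psi> c
        by (rule bivectorD(3)[OF \<pi> that \<epsilon> \<epsilon>])
    qed
  qed
qed

lemma smooth_sectionsI:
  assumes "\<And>x. X x \<in> fibre A x"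
    and "\<And>U e. (U, e) \<in> frames A \<Longrightarrow> \<exists>c. (\<forall>i<bundle_rank A. smooth_on A U (c i)) \<and>
       (\<forall>x\<in>U. X x = (\<Sum>i<bundle_rank A. c i x *\<^sub>R e i x))"
  shows "X \<in> smooth_sections A"
  unfolding smooth_sections_def mem_Collect_eq
proof (intro conjI allI)
  show "X x \<in> fibre A x" for x by (rule assms(1))
  show "\<forall>(U, e)\<in>frames A. \<exists>c. (\<forall>i<bundle_rank A. smooth_on A U (c i)) \<and>
       (\<forall>x\<in>U. X x = (\<Sum>i<bundle_rank A. c i x *\<^sub>R e i x))"
    by clarify (rule assms(2))
qed

lemma sharp_section:
  assumes A: "vector_bundle A" and \<pi>: "\<pi> \<in> bivectors A" and \<alpha>: "\<alpha> \<in> one_forms A"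
  shows "on_sections (sharp A \<pi>) \<alpha> \<in> smooth_sections A"
proof (rule smooth_sectionsI)
  show "on_sections (sharp A \<pi>) \<alpha> x \<in> fibre A x" for x
    unfolding on_sections_def by (rule sharp_props(1)[OF A \<pi> one_form_dual[OF \<alpha>]])
  fix U e assume U: "(U, e) \<in> frames A"
  have "smooth_on A U (\<lambda>x. \<alpha> x (e i x))" if "i < bundle_rank A" for i
  proof -
    have "\<forall>(U, e)\<in>frames A. \<forall>i<bundle_rank A. smooth_on A U (\<lambda>x. \<alpha> x (e i x))"
      using \<alpha> by (simp add: one_forms_def)
    from bspec[OF this U] that show ?thesis by simp
  qed
  then show "\<exists>c. (\<forall>i<bundle_rank A. smooth_on A U (c i)) \<and>
       (\<forall>x\<in>U. on_sections (sharp A \<pi>) \<alpha> x = (\<Sum>i<bundle_rank A. c i x *\<^sub>R e i x))"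
    unfolding on_sections_def by (rule sharp_frame_smooth[OF A U \<pi> one_form_dual[OF \<alpha>]])
qed

section \<open>2-forms and the flat map\<close>

lemma two_formD:
  assumes "\<omega> \<in> two_forms A" "v \<in> fibre A x"
  shows "lin_on (fibre A x) (\<omega> x v)" and "lin_on (fibre A x) (\<lambda>u. \<omega> x u v)" and "\<omega> x v v = 0"
  using assms by (simp_all add: two_forms_def)

lemma two_form_skew:
  assumes \<omega>: "\<omega> \<in> two_forms A" and S: "subspace (fibre A x)" and v: "v \<in> fibre A x" and w: "w \<in> fibre A x"
  shows "\<omega> x v w = - \<omega> x w v"
proof -
  have s: "v + w \<in> fibre A x" using S v w by (rule subspace_add)
  have "\<omega> x (v + w) (v + w) = \<omega> x (v + w) v + \<omega> x (v + w) w"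
    using two_formD(1)[OF \<omega> s] v w unfolding lin_on_def by blast
  also have "\<omega> x (v + w) v = \<omega> x v v + \<omega> x w v"
    using two_formD(2)[OF \<omega> v] v w unfolding lin_on_def by blast
  also have "\<omega> x (v + w) w = \<omega> x v w + \<omega> x w w"
    using two_formD(2)[OF \<omega> w] v w unfolding lin_on_def by blast
  finally show ?thesis
    using two_formD(3)[OF \<omega>] v w s by simp
qed

lemma two_form_smooth:
  assumes "\<omega> \<in> two_forms A" "(U, e) \<in> frames A" "i < bundle_rank A" "j < bundle_rank A"
  shows "smooth_on A U (\<lambda>x. \<omega> x (e i x) (e j x))"
proof -
  have "\<forall>(U, e)\<in>frames A. \<forall>i<bundle_rank A. \<forall>j<bundle_rank A. smooth_on A U (\<lambda>x. \<omega> x (e i x) (e j x))"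
    using assms(1) by (simp add: two_forms_def)
  from bspec[OF this assms(2)] show ?thesis using assms(3,4) by simp
qed

lemma flat_dual:
  assumes \<omega>: "\<omega> \<in> two_forms A" and S: "subspace (fibre A x)" and v: "v \<in> fibre A x"
  shows "flat A \<omega> x v \<in> dual_fibre A x"
  using two_formD(1)[OF \<omega> v] S
  by (auto simp: dual_fibre_def flat_def lin_on_def subspace_add subspace_scale)

lemma flat_section:
  assumes A: "vector_bundle A" and \<omega>: "\<omega> \<in> two_forms A" and X: "X \<in> smooth_sections A"
  shows "on_sections (flat A \<omega>) X \<in> one_forms A"
  unfolding one_forms_def mem_Collect_eq
proof (intro conjI allI)
  show "on_sections (flat A \<omega>) X x \<in> dual_fibre A x" for x
    unfolding on_sections_def by (rule flat_dual[OF \<omega> vector_bundleD(2)[OF A] sectionD[OF X]])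
  show "\<forall>(U, e)\<in>frames A. \<forall>i<bundle_rank A. smooth_on A U (\<lambda>x. on_sections (flat A \<omega>) X x (e i x))"
  proof (clarify)
    fix U e i assume U: "(U, e) \<in> frames A" and i: "i < bundle_rank A"
    note M = vector_bundleD(1)[OF A] and Uo = vector_bundleD(4)[OF A U]
    from section_frame[OF X U] obtain c where "\<forall>i<bundle_rank A. smooth_on A U (c i)"
      "\<forall>x\<in>U. X x = (\<Sum>i<bundle_rank A. c i x *\<^sub>R e i x)"
      by (elim exE conjE)
    note c = this[rule_format]
    have "smooth_on A U (\<lambda>x. \<Sum>j<bundle_rank A. c j x * \<omega> x (e j x) (e i x))"
      by (intro smooth_on_sum[OF M Uo] smooth_on_mult[OF M Uo] c(1) two_form_smooth[OF \<omega> U] i)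
    then show "smooth_on A U (\<lambda>x. on_sections (flat A \<omega>) X x (e i x))"
    proof (rule smooth_on_cong[OF M Uo, rotated])
      fix x assume x: "x \<in> U"
      note ef = vector_bundleD(5)[OF A U x]
      show "(\<Sum>j<bundle_rank A. c j x * \<omega> x (e j x) (e i x)) = on_sections (flat A \<omega>) X x (e i x)"
        using lin_on_sum[OF vector_bundleD(2)[OF A] two_formD(2)[OF \<omega> ef[OF i]], where e = "\<lambda>i. e i x"] ef i c(2)[OF x]
        by (simp add: on_sections_def flat_def)
    qed
  qed
qed

lemma two_form_apply_smooth:
  assumes A: "vector_bundle A" and \<omega>: "\<omega> \<in> two_forms A"
    and X: "X \<in> smooth_sections A" and Y: "Y \<in> smooth_sections A"
  shows "(\<lambda>x. \<omega> x (X x) (Y x)) \<in> smooth_funs A"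
  using one_form_apply_smooth[OF A flat_section[OF A \<omega> X] Y] sectionD[OF Y]
  by (simp add: on_sections_def flat_def)

text \<open>Meant for the transition tensors, which pair \<pi> and \<omega> of different indices;
  hence \<pi> is not assumed to be the inverse of \<omega>.\<close>

lemma sharp_flat_endo:
  assumes A: "vector_bundle A" and \<omega>: "\<omega> \<in> two_forms A" and \<pi>: "\<pi> \<in> bivectors A"
  shows "(\<lambda>x v. sharp A \<pi> x (flat A \<omega> x v)) \<in> bundle_endos A"
  unfolding bundle_endos_def mem_Collect_eq
proof (intro conjI allI ballI)
  note S = vector_bundleD(2)[OF A]
  note fd = flat_dual[OF \<omega> S]
  show "sharp A \<pi> x (flat A \<omega> x v) \<in> fibre A x" if "v \<in> fibre A x" for x v
    by (rule sharp_props(1)[OF A \<pi> fd[OF that]])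
  have add: "flat A \<omega> x (u + v) = (\<lambda>w. flat A \<omega> x u w + flat A \<omega> x v w)"
    if "u \<in> fibre A x" "v \<in> fibre A x" for x u v
    using that two_formD(2)[OF \<omega>] by (auto simp: flat_def lin_on_def)
  have scale: "flat A \<omega> x (c *\<^sub>R u) = (\<lambda>w. c * flat A \<omega> x u w)" if "u \<in> fibre A x" for x u c
    using that two_formD(2)[OF \<omega>] by (auto simp: flat_def lin_on_def)
  show "lin_on (fibre A x) (\<lambda>v. sharp A \<pi> x (flat A \<omega> x v))" for x
    unfolding lin_on_def
    by (simp add: add scale sharp_props(3)[OF A \<pi> fd fd] sharp_props(4)[OF A \<pi> fd])
  show "case p of (U, e) \<Rightarrow> \<forall>j<bundle_rank A. \<exists>c. (\<forall>i<bundle_rank A. smooth_on A U (c i)) \<and>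
       (\<forall>x\<in>U. sharp A \<pi> x (flat A \<omega> x (e j x)) = (\<Sum>i<bundle_rank A. c i x *\<^sub>R e i x))"
    if p: "p \<in> frames A" for p
  proof -
    obtain U e where Ue: "p = (U, e)" by (cases p)
    then have U: "(U, e) \<in> frames A" using p by simp
    note M = vector_bundleD(1)[OF A] and Uo = vector_bundleD(4)[OF A U]
    note ef = vector_bundleD(5)[OF A U]
    have "\<exists>c. (\<forall>i<bundle_rank A. smooth_on A U (c i)) \<and>
       (\<forall>x\<in>U. sharp A \<pi> x (flat A \<omega> x (e j x)) = (\<Sum>i<bundle_rank A. c i x *\<^sub>R e i x))"
      if j: "j < bundle_rank A" for j
    proof (rule sharp_frame_smooth[OF A U \<pi>])
      show "flat A \<omega> x (e j x) \<in> dual_fibre A x" if "x \<in> U" for x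
        by (rule fd[OF ef[OF that j]])
      show "smooth_on A U (\<lambda>x. flat A \<omega> x (e j x) (e i x))" if i: "i < bundle_rank A" for i
        by (rule smooth_on_cong[OF M Uo _ two_form_smooth[OF \<omega> U j i]]) (simp add: flat_def ef i)
    qed
    then show ?thesis using Ue by simp
  qed
qed

section \<open>Bundle endomorphisms acting on sections\<close>

lemma bundle_endoD:
  assumes "N \<in> bundle_endos A"
  shows "lin_on (fibre A x) (N x)" and "v \<in> fibre A x \<Longrightarrow> N x v \<in> fibre A x"
    and "(U, e) \<in> frames A \<Longrightarrow> j < bundle_rank A \<Longrightarrow> \<exists>c. (\<forall>i<bundle_rank A. smooth_on A U (c i)) \<and>
           (\<forall>x\<in>U. N x (e j x) = (\<Sum>i<bundle_rank A. c i x *\<^sub>R e i x))"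
proof -
  show "lin_on (fibre A x) (N x)" "v \<in> fibre A x \<Longrightarrow> N x v \<in> fibre A x"
    using assms by (simp_all add: bundle_endos_def)
  have "\<forall>(U, e)\<in>frames A. \<forall>j<bundle_rank A. \<exists>c. (\<forall>i<bundle_rank A. smooth_on A U (c i)) \<and>
           (\<forall>x\<in>U. N x (e j x) = (\<Sum>i<bundle_rank A. c i x *\<^sub>R e i x))"
    using assms by (simp add: bundle_endos_def)
  from bspec[OF this, of "(U, e)"]
  show "(U, e) \<in> frames A \<Longrightarrow> j < bundle_rank A \<Longrightarrow> \<exists>c. (\<forall>i<bundle_rank A. smooth_on A U (c i)) \<and>
           (\<forall>x\<in>U. N x (e j x) = (\<Sum>i<bundle_rank A. c i x *\<^sub>R e i x))"
    by simp
qed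

lemma endo_section:
  assumes A: "vector_bundle A" and N: "N \<in> bundle_endos A" and X: "X \<in> smooth_sections A"
  shows "on_sections N X \<in> smooth_sections A"
proof (rule smooth_sectionsI)
  show "on_sections N X x \<in> fibre A x" for x
    unfolding on_sections_def by (rule bundle_endoD(2)[OF N sectionD[OF X]])
  fix U e assume U: "(U, e) \<in> frames A"
  note M = vector_bundleD(1)[OF A] and Uo = vector_bundleD(4)[OF A U]
  from section_frame[OF X U] obtain c where "\<forall>i<bundle_rank A. smooth_on A U (c i)"
    "\<forall>x\<in>U. X x = (\<Sum>i<bundle_rank A. c i x *\<^sub>R e i x)"
    by (elim exE conjE)
  note c = this[rule_format]
  \<comment> \<open>The bound on j is placed under the existential so that \<open>choice\<close>
    yields a single coefficient matrix d, with columns indexed by j.\<close>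
  have "\<forall>j. \<exists>d. j < bundle_rank A \<longrightarrow> (\<forall>i<bundle_rank A. smooth_on A U (d i)) \<and>
           (\<forall>x\<in>U. N x (e j x) = (\<Sum>i<bundle_rank A. d i x *\<^sub>R e i x))"
    using bundle_endoD(3)[OF N U] by blast
  from choice[OF this] obtain d where d: "\<forall>j. j < bundle_rank A \<longrightarrow> (\<forall>i<bundle_rank A. smooth_on A U (d j i)) \<and>
           (\<forall>x\<in>U. N x (e j x) = (\<Sum>i<bundle_rank A. d j i x *\<^sub>R e i x))"
    by (elim exE)
  show "\<exists>c. (\<forall>i<bundle_rank A. smooth_on A U (c i)) \<and>
       (\<forall>x\<in>U. on_sections N X x = (\<Sum>i<bundle_rank A. c i x *\<^sub>R e i x))"
  proof (intro exI[of _ "\<lambda>i x. \<Sum>j<bundle_rank A. c j x * d j i x"] conjI allI impI ballI)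
    show "smooth_on A U (\<lambda>x. \<Sum>j<bundle_rank A. c j x * d j i x)" if "i < bundle_rank A" for i
      using d that by (intro smooth_on_sum[OF M Uo] smooth_on_mult[OF M Uo] c(1)) simp_all
    fix x assume x: "x \<in> U"
    have "N x (X x) = (\<Sum>j<bundle_rank A. c j x *\<^sub>R N x (e j x))"
      unfolding c(2)[OF x]
      by (rule lin_on_sum[OF vector_bundleD(2)[OF A] bundle_endoD(1)[OF N] vector_bundleD(5)[OF A U x]])
    also have "\<dots> = (\<Sum>j<bundle_rank A. \<Sum>i<bundle_rank A. (c j x * d j i x) *\<^sub>R e i x)"
      using d x by (simp add: scaleR_sum_right)
    also have "\<dots> = (\<Sum>i<bundle_rank A. (\<Sum>j<bundle_rank A. c j x * d j i x) *\<^sub>R e i x)"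
      by (subst sum.swap) (simp add: scaleR_sum_left)
    finally show "on_sections N X x = (\<Sum>i<bundle_rank A. (\<Sum>j<bundle_rank A. c j x * d j i x) *\<^sub>R e i x)"
      by (simp add: on_sections_def)
  qed
qed

subsection \<open>Closed 2-forms\<close>

lemma anchor_on_scale:
  assumes A: "lie_algebroid A" and X: "X \<in> smooth_sections A" and f: "f \<in> smooth_funs A"
  shows "anchor_on A X (\<lambda>y. c * f y) x = c * anchor_on A X f x"
  using lie_algebroidD(1)[OF A sectionD[OF X], of x] f
  unfolding tangent_vector_def anchor_on_def by blast

text \<open>The differential is linear over the reals and evaluates a form on fibre vectors only. So
  proportionality on the fibres suffices, whatever the values of the two functions on the rest of
  the type \<open>'v\<close>.\<close>

lemma closed2_scale:
  assumes A: "lie_algebroid A" and \<omega>: "\<omega> \<in> two_forms A" and d: "closed2 A \<omega>"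
    and eq: "\<And>x v w. v \<in> fibre A x \<Longrightarrow> w \<in> fibre A x \<Longrightarrow> \<omega>' x v w = c * \<omega> x v w"
  shows "closed2 A \<omega>'"
  unfolding closed2_def
proof (intro ballI allI)
  fix X Y Z x
  assume X: "X \<in> smooth_sections A" and Y: "Y \<in> smooth_sections A" and Z: "Z \<in> smooth_sections A"
  note vb = lie_algebroid_vb[OF A]
  note sec = sectionD[OF X] sectionD[OF Y] sectionD[OF Z] sectionD[OF bracket_rules(1)[OF A X Y]]
    sectionD[OF bracket_rules(1)[OF A X Z]] sectionD[OF bracket_rules(1)[OF A Y Z]]
  note sm = two_form_apply_smooth[OF vb \<omega>]
  have "differential2 A \<omega>' X Y Z x = c * differential2 A \<omega> X Y Z x"
    unfolding differential2_def
    by (simp add: eq sec anchor_on_scale[OF A X sm[OF Y Z]] anchor_on_scale[OF A Y sm[OF X Z]]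
        anchor_on_scale[OF A Z sm[OF X Y]] algebra_simps)
  then show "differential2 A \<omega>' X Y Z x = 0"
    using d X Y Z by (simp add: closed2_def)
qed

subsection \<open>Symplectic forms with a self-adjoint endomorphism\<close>

text \<open>The situation common to i = k - 1 and i = k + 1, with N the transition tensor of index
  k.\<close>

locale symplectic_endo =
  fixes A :: "('m::{t2_space,second_countable_topology}, 'v::real_vector, 'z) lie_algebroid_scheme"
    and \<omega> :: "'m \<Rightarrow> 'v \<Rightarrow> 'v \<Rightarrow> real"
    and \<pi> :: "'m \<Rightarrow> ('v \<Rightarrow> real) \<Rightarrow> ('v \<Rightarrow> real) \<Rightarrow> real"
    and N :: "'m \<Rightarrow> 'v \<Rightarrow> 'v"
  assumes algebroid: "lie_algebroid A"
    and symplectic: "symplectic_form A \<omega>"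
    and inverse: "inverse_bivector A \<omega> \<pi>"
    and endo: "N \<in> bundle_endos A"
    and self_adjoint: "v \<in> fibre A x \<Longrightarrow> w \<in> fibre A x \<Longrightarrow> \<omega> x v (N x w) = \<omega> x (N x v) w"
    and closed_N: "closed2 A (\<lambda>x v w. \<omega> x (N x v) w)"
begin

lemma two_form: "\<omega> \<in> two_forms A" and closed: "closed2 A \<omega>"
  using symplectic by (simp_all add: symplectic_form_def)

lemma bivector: "\<pi> \<in> bivectors A"
  using inverse by (simp add: inverse_bivector_def)

lemma vb: "vector_bundle A"
  by (rule lie_algebroid_vb[OF algebroid])

lemma N_section: "X \<in> smooth_sections A \<Longrightarrow> on_sections N X \<in> smooth_sections A"
  by (rule endo_section[OF vb endo])

lemma bracket_fibre:
  "X \<in> smooth_sections A \<Longrightarrow> Y \<in> smooth_sections A \<Longrightarrow> bracket A X Y x \<in> fibre A x"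
  by (rule sectionD[OF bracket_rules(1)[OF algebroid]])

text \<open>The rules of linearity and self-adjointness below are conditional on membership in the
  fibre; these facts discharge the conditions during simplification.\<close>

lemmas fibre_intros = sectionD bracket_fibre N_section bundle_endoD(2)[OF endo]
  subspace_add[OF vector_bundleD(2)[OF vb]] subspace_diff[OF vector_bundleD(2)[OF vb]]
  subspace_neg[OF vector_bundleD(2)[OF vb]]

lemma N_linear:
  assumes u: "u \<in> fibre A x" and v: "v \<in> fibre A x"
  shows "N x (u + v) = N x u + N x v" and "N x (u - v) = N x u - N x v"
proof -
  note l = bundle_endoD(1)[OF endo, of x]
  have add: "N x (u + v) = N x u + N x v" if "v \<in> fibre A x" for v
    using l u that by (simp add: lin_on_def)
  then show "N x (u + v) = N x u + N x v" using v .
  have "N x (- 1 *\<^sub>R v) = - 1 *\<^sub>R N x v"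
    using l v unfolding lin_on_def by blast
  then show "N x (u - v) = N x u - N x v"
    using add[of "- v"] subspace_neg[OF vector_bundleD(2)[OF vb] v] by simp
qed

lemma form_uminus:
  assumes v: "v \<in> fibre A x" and w: "w \<in> fibre A x"
  shows "\<omega> x (- v) w = - \<omega> x v w" "\<omega> x w (- v) = - \<omega> x w v"
proof -
  have "\<omega> x (- 1 *\<^sub>R v) w = - 1 *\<^sub>R \<omega> x v w"
    using two_formD(2)[OF two_form w] v unfolding lin_on_def by blast
  then show "\<omega> x (- v) w = - \<omega> x v w" by simp
  have "\<omega> x w (- 1 *\<^sub>R v) = - 1 *\<^sub>R \<omega> x w v"
    using two_formD(1)[OF two_form w] v unfolding lin_on_def by blast
  then show "\<omega> x w (- v) = - \<omega> x w v" by simp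
qed

lemma form_linear:
  assumes u: "u \<in> fibre A x" and v: "v \<in> fibre A x" and w: "w \<in> fibre A x"
  shows "\<omega> x (u + v) w = \<omega> x u w + \<omega> x v w" "\<omega> x (u - v) w = \<omega> x u w - \<omega> x v w"
    and "\<omega> x w (u + v) = \<omega> x w u + \<omega> x w v" "\<omega> x w (u - v) = \<omega> x w u - \<omega> x w v"
proof -
  have addl: "\<omega> x (u + v) w = \<omega> x u w + \<omega> x v w" if "v \<in> fibre A x" for v
    using two_formD(2)[OF two_form w] u that by (simp add: lin_on_def)
  have addr: "\<omega> x w (u + v) = \<omega> x w u + \<omega> x w v" if "v \<in> fibre A x" for v
    using two_formD(1)[OF two_form w] u that by (simp add: lin_on_def)
  show "\<omega> x (u + v) w = \<omega> x u w + \<omega> x v w" "\<omega> x (u - v) w = \<omega> x u w - \<omega> x v w"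
    and "\<omega> x w (u + v) = \<omega> x w u + \<omega> x w v" "\<omega> x w (u - v) = \<omega> x w u - \<omega> x w v"
    using addl[OF v] addl[of "- v"] addr[OF v] addr[of "- v"] form_uminus[OF v w]
      subspace_neg[OF vector_bundleD(2)[OF vb] v] by simp_all
qed

lemma skew: "v \<in> fibre A x \<Longrightarrow> w \<in> fibre A x \<Longrightarrow> \<omega> x v w = - \<omega> x w v"
  by (rule two_form_skew[OF two_form vector_bundleD(2)[OF vb]])

lemma on_sections_apply: "on_sections F X x = F x (X x)"
  by (simp add: on_sections_def)

section \<open>The torsion of N\<close>

text \<open>Self-adjointness moves every N into the first argument of \<omega>. Then the anchor
  terms and all terms with a bracket against Z cancel, and the brackets of X, Y, NX and NY that
  remain form the torsion.\<close>

lemma torsion_identity: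
  assumes X: "X \<in> smooth_sections A" and Y: "Y \<in> smooth_sections A" and Z: "Z \<in> smooth_sections A"
  shows "\<omega> x (torsion A N X Y x) (Z x) =
      differential2 A (\<lambda>x v w. \<omega> x (N x v) w) (on_sections N X) Y Z x
    + differential2 A (\<lambda>x v w. \<omega> x (N x v) w) X (on_sections N Y) Z x
    - differential2 A \<omega> (on_sections N X) (on_sections N Y) Z x
    - differential2 A (\<lambda>x v w. \<omega> x (N x (N x v)) w) X Y Z x"
  unfolding differential2_def torsion_def deformed_bracket_def
  by (simp add: on_sections_apply self_adjoint fibre_intros N_linear form_linear X Y Z)

lemma torsion_free:
  assumes "closed2 A (\<lambda>x v w. \<omega> x (N x (N x v)) w)"
  shows "torsion_free A N"
  unfolding torsion_free_def
proof (intro ballI allI)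
  fix X Y x assume X: "X \<in> smooth_sections A" and Y: "Y \<in> smooth_sections A"
  have "torsion A N X Y x \<in> fibre A x"
    unfolding torsion_def deformed_bracket_def
    by (simp add: fibre_intros X Y)
  moreover have "\<omega> x (torsion A N X Y x) w = 0" if w: "w \<in> fibre A x" for w
  proof -
    \<comment> \<open>\<open>torsion_identity\<close> tests the torsion only against values of
      sections, while nondegeneracy asks for every vector of the fibre.\<close>
    obtain Z where Z: "Z \<in> smooth_sections A" "Z x = w"
      by (rule section_through[OF vb w]) blast
    show ?thesis
      using torsion_identity[OF X Y Z(1), of x] assms closed closed_N X Y Z N_section
      by (simp add: closed2_def)
  qed
  ultimately show "torsion A N X Y x = 0"
    using symplectic by (simp add: symplectic_form_def)
qed

section \<open>From 1-forms to sections, and the Schouten bracket of the inverse bivector\<close>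

lemma flat_sharp: "\<phi> \<in> dual_fibre A x \<Longrightarrow> flat A \<omega> x (sharp A \<pi> x \<phi>) = \<phi>"
  and sharp_flat: "v \<in> fibre A x \<Longrightarrow> sharp A \<pi> x (flat A \<omega> x v) = v"
  using inverse by (simp_all add: inverse_bivector_def)

text \<open>Taking X as the sharp of \<alpha> reduces claims about all 1-forms to identities between
  sections.\<close>

lemma one_form_flat:
  assumes \<alpha>: "\<alpha> \<in> one_forms A"
  obtains X where "X \<in> smooth_sections A" "\<alpha> = on_sections (flat A \<omega>) X"
proof (rule that)
  show "on_sections (sharp A \<pi>) \<alpha> \<in> smooth_sections A"
    by (rule sharp_section[OF vb bivector \<alpha>])
  show "\<alpha> = on_sections (flat A \<omega>) (on_sections (sharp A \<pi>) \<alpha>)"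
    by (simp add: fun_eq_iff on_sections_apply flat_sharp[OF one_form_dual[OF \<alpha>]])
qed

lemma sharp_flat_section:
  "X \<in> smooth_sections A \<Longrightarrow> on_sections (sharp A \<pi>) (on_sections (flat A \<omega>) X) = X"
  by (simp add: fun_eq_iff on_sections_apply sharp_flat sectionD)

lemma flat_apply: "w \<in> fibre A x \<Longrightarrow> on_sections (flat A \<omega>) X x w = \<omega> x (X x) w"
  by (simp add: on_sections_apply flat_def)

lemma anchor_on_uminus:
  "U \<in> smooth_sections A \<Longrightarrow> X \<in> smooth_sections A \<Longrightarrow> Y \<in> smooth_sections A \<Longrightarrow>
    anchor_on A U (\<lambda>y. - \<omega> y (X y) (Y y)) x = - anchor_on A U (\<lambda>y. \<omega> y (X y) (Y y)) x"
  using anchor_on_scale[OF algebroid _ two_form_apply_smooth[OF vb two_form], of U X Y "- 1"] by simp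

text \<open>Since sharp inverts flat, the two summands of each cyclic term coincide, which gives the
  factor 2; one copy of the cyclic sum is the Cartan formula for d\<omega> up to
  skew-symmetry.\<close>

lemma schouten_flat:
  assumes X: "X \<in> smooth_sections A" and Y: "Y \<in> smooth_sections A" and Z: "Z \<in> smooth_sections A"
  shows "schouten_bracket A \<pi> \<pi> (on_sections (flat A \<omega>) X) (on_sections (flat A \<omega>) Y)
      (on_sections (flat A \<omega>) Z) x = 2 * differential2 A \<omega> X Y Z x"
proof -
  \<comment> \<open>Oriented instances of skew-symmetry give a normal form: X stands before Z, and
    brackets stand in the first argument.\<close>
  have f: "\<omega> y (Z y) (X y) = - \<omega> y (X y) (Z y)" for y
    by (rule skew[OF sectionD[OF Z] sectionD[OF X]])
  have b: "\<omega> x (U x) (bracket A V W x) = - \<omega> x (bracket A V W x) (U x)"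
    if "U \<in> smooth_sections A" "V \<in> smooth_sections A" "W \<in> smooth_sections A" for U V W
    using that by (simp add: skew[OF sectionD bracket_fibre])
  show ?thesis
    unfolding schouten_bracket_def schouten_cyclic_term_def lie_derivative_def differential2_def
    by (simp add: sharp_flat_section flat_apply fibre_intros X Y Z f b anchor_on_uminus form_uminus
        bracket_rules(2)[OF algebroid Y X] bracket_rules(2)[OF algebroid Z Y])
qed

section \<open>The Magri-Morosi concomitant\<close>

text \<open>D stands for A or for \<open>deformed A N\<close>. The latter need not be a Lie
  algebroid, so the values of its bracket are assumed to lie in the fibre. The last term comes from
  \<pi>(flat X, flat Z) = \<omega>(Z, X).\<close>

lemma bivector_bracket_flat:
  fixes D :: "('m, 'v, 'z) lie_algebroid_scheme"
  assumes X: "X \<in> smooth_sections A" and Z: "Z \<in> smooth_sections A" and Y: "Y \<in> smooth_sections A"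
    and sharp: "sharp D \<pi> = sharp A \<pi>"
    and br: "bracket D X Y x \<in> fibre A x" "bracket D Z Y x \<in> fibre A x"
  shows "bivector_bracket D \<pi> (on_sections (flat A \<omega>) X) (on_sections (flat A \<omega>) Z) Y x =
      anchor_on D X (\<lambda>y. \<omega> y (Z y) (Y y)) x - \<omega> x (Z x) (bracket D X Y x)
    - anchor_on D Z (\<lambda>y. \<omega> y (X y) (Y y)) x + \<omega> x (X x) (bracket D Z Y x)
    - anchor_on D Y (\<lambda>y. \<omega> y (Z y) (X y)) x"
proof -
  have "\<pi> y (on_sections (flat A \<omega>) X y) (on_sections (flat A \<omega>) Z y) = \<omega> y (Z y) (X y)" for y
  proof -
    note d = one_form_dual[OF flat_section[OF vb two_form]]
    have "\<pi> y (on_sections (flat A \<omega>) X y) (on_sections (flat A \<omega>) Z y) =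
        on_sections (flat A \<omega>) Z y (sharp A \<pi> y (on_sections (flat A \<omega>) X y))"
      by (rule sharp_props(2)[OF vb bivector d[OF X] d[OF Z], symmetric])
    then show ?thesis
      using fun_cong[OF sharp_flat_section[OF X], of y] sectionD[OF X, of y]
      by (simp add: on_sections_apply flat_def)
  qed
  then show ?thesis
    unfolding bivector_bracket_def lie_derivative_def sharp
    by (simp add: sharp_flat_section flat_apply fibre_intros X Y Z br)
qed

lemma transpose_flat_section:
  assumes X: "X \<in> smooth_sections A"
  shows "on_sections (transpose_endo A N) (on_sections (flat A \<omega>) X) =
    on_sections (flat A \<omega>) (on_sections N X)"
  using sectionD[OF X]
  by (auto simp: fun_eq_iff on_sections_apply transpose_endo_def flat_def self_adjoint fibre_intros)

text \<open>For A the formula of \<open>bivector_bracket_flat\<close> equals d\<omega>(X, Z, Y) +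
  \<omega>([X, Z], Y), and likewise for the deformed structure with its operator d_N. The terms
  \<omega>([_, _], _) cancel by the definition of the deformed bracket. The rest follows from d_N
  \<omega>(X, Z, Y) = d\<omega>(NX, Z, Y) + d\<omega>(X, NZ, Y) + d\<omega>(X, Z, NY) - 2
  d\<omega>_N(X, Z, Y). The proof compares the fully expanded terms.\<close>

lemma magri_morosi_flat:
  assumes X: "X \<in> smooth_sections A" and Z: "Z \<in> smooth_sections A" and Y: "Y \<in> smooth_sections A"
  shows "magri_morosi A \<pi> N (on_sections (flat A \<omega>) X) (on_sections (flat A \<omega>) Z) Y x =
    2 * (differential2 A \<omega> X Z (on_sections N Y) x
       - differential2 A (\<lambda>x v w. \<omega> x (N x v) w) X Z Y x)"
proof -
  \<comment> \<open>The sharp map depends only on the fibres and \<pi>, which the deformation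
    keeps.\<close>
  have sh: "sharp (deformed A N) \<pi> = sharp A \<pi>"
    by (simp add: fun_eq_iff sharp_def deformed_def dual_fibre_def)
  have an: "anchor_on (deformed A N) U = anchor_on A (on_sections N U)" for U
    by (simp add: fun_eq_iff anchor_on_def deformed_def on_sections_def)
  have br: "bracket (deformed A N) = deformed_bracket A N"
    by (simp add: deformed_def)
  have brf: "bracket (deformed A N) U V x \<in> fibre A x"
    if "U \<in> smooth_sections A" "V \<in> smooth_sections A" for U V
    using that by (simp add: br deformed_bracket_def fibre_intros)
  note NX = N_section[OF X] and NY = N_section[OF Y] and NZ = N_section[OF Z]
  have f: "\<omega> y (Z y) (X y) = - \<omega> y (X y) (Z y)" for y
    by (rule skew[OF sectionD[OF Z] sectionD[OF X]])
  \<comment> \<open>Self-adjointness makes \<omega>_N skew-symmetric.\<close>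
  have fN: "\<omega> y (N y (Z y)) (X y) = - \<omega> y (N y (X y)) (Z y)" for y
    using skew[OF sectionD[OF NZ] sectionD[OF X], of y]
    by (simp add: on_sections_apply self_adjoint sectionD X Z)
  have anN: "anchor_on A U (\<lambda>y. - \<omega> y (N y (X y)) (Z y)) x = - anchor_on A U (\<lambda>y. \<omega> y (N y (X y)) (Z y)) x"
    if "U \<in> smooth_sections A" for U
    using anchor_on_uminus[OF that NX Z] by (simp add: on_sections_apply)
  have b: "\<omega> x (U x) (bracket A V W x) = - \<omega> x (bracket A V W x) (U x)"
    "\<omega> x (N x (U x)) (bracket A V W x) = - \<omega> x (N x (bracket A V W x)) (U x)"
    if "U \<in> smooth_sections A" "V \<in> smooth_sections A" "W \<in> smooth_sections A" for U V W
    using that skew[OF sectionD bracket_fibre, of U V W x]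
      skew[OF sectionD[OF N_section] bracket_fibre, of U V W x]
    by (simp_all add: on_sections_apply self_adjoint fibre_intros)
  show ?thesis
    unfolding magri_morosi_def transpose_flat_section[OF X] transpose_flat_section[OF Z]
    unfolding bivector_bracket_flat[OF X Z Y sh brf[OF X Y] brf[OF Z Y]]
      bivector_bracket_flat[OF NX Z Y refl bracket_fibre[OF NX Y] bracket_fibre[OF Z Y]]
      bivector_bracket_flat[OF X NZ Y refl bracket_fibre[OF X Y] bracket_fibre[OF NZ Y]]
      bivector_bracket_flat[OF X Z NY refl bracket_fibre[OF X NY] bracket_fibre[OF Z NY]]
    unfolding br an differential2_def deformed_bracket_def
    by (simp add: on_sections_apply self_adjoint fibre_intros X Y Z f fN anN b anchor_on_uminus
        form_linear N_linear)
qed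

lemma PN_and_OmegaN:
  assumes NN: "closed2 A (\<lambda>x v w. \<omega> x (N x (N x v)) w)"
  shows "PN_structure A \<pi> N" and "OmegaN_structure A \<omega> N"
proof -
  have tr: "flat A \<omega> x (N x v) = transpose_endo A N x (flat A \<omega> x v)" if "v \<in> fibre A x" for x v
    using that by (auto simp: fun_eq_iff flat_def transpose_endo_def self_adjoint fibre_intros)
  show "OmegaN_structure A \<omega> N"
    unfolding OmegaN_structure_def
    using two_form endo closed torsion_free[OF NN] closed_N tr by simp
  show "PN_structure A \<pi> N"
    unfolding PN_structure_def
  proof (intro conjI ballI allI bivector endo torsion_free[OF NN])
    fix \<alpha> \<beta> \<gamma> x assume "\<alpha> \<in> one_forms A" "\<beta> \<in> one_forms A" "\<gamma> \<in> one_forms A"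
    then obtain X Y Z where "X \<in> smooth_sections A" "Y \<in> smooth_sections A" "Z \<in> smooth_sections A"
      "\<alpha> = on_sections (flat A \<omega>) X" "\<beta> = on_sections (flat A \<omega>) Y" "\<gamma> = on_sections (flat A \<omega>) Z"
      by (elim one_form_flat)
    then show "schouten_bracket A \<pi> \<pi> \<alpha> \<beta> \<gamma> x = 0"
      using closed by (simp add: schouten_flat closed2_def)
  next
    fix x \<phi> assume \<phi>: "\<phi> \<in> dual_fibre A x"
    \<comment> \<open>With v the sharp of \<phi>, \<phi> is the flat of v; the claim is
      \<open>tr\<close> at v with sharp applied to both sides.\<close>
    note v = sharp_props(1)[OF vb bivector \<phi>]
    show "N x (sharp A \<pi> x \<phi>) = sharp A \<pi> x (transpose_endo A N x \<phi>)"
      using tr[OF v] sharp_flat[OF bundle_endoD(2)[OF endo v]] flat_sharp[OF \<phi>] by simp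
  next
    fix \<alpha> \<beta> Y x assume "\<alpha> \<in> one_forms A" "\<beta> \<in> one_forms A" and Y: "Y \<in> smooth_sections A"
    then obtain X Z where "X \<in> smooth_sections A" "Z \<in> smooth_sections A"
      "\<alpha> = on_sections (flat A \<omega>) X" "\<beta> = on_sections (flat A \<omega>) Z"
      by (elim one_form_flat)
    then show "magri_morosi A \<pi> N \<alpha> \<beta> Y x = 0"
      using Y closed closed_N N_section[OF Y] by (simp add: magri_morosi_flat closed2_def)
  qed
qed

end

subsection \<open>Hypersymplectic triples\<close>

theorem corollary4p3:
  fixes A :: "('m::{t2_space,second_countable_topology}, 'v::real_vector) lie_algebroid"
    and \<epsilon> :: "3 \<Rightarrow> real"
    and \<omega> :: "3 \<Rightarrow> 'm \<Rightarrow> 'v \<Rightarrow> 'v \<Rightarrow> real"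
    and \<pi> :: "3 \<Rightarrow> 'm \<Rightarrow> ('v \<Rightarrow> real) \<Rightarrow> ('v \<Rightarrow> real) \<Rightarrow> real"
    and i k :: 3
  assumes "lie_algebroid A"
    and "hypersymplectic A \<epsilon> \<omega> \<pi>"
    and "i \<noteq> k"
  shows "PN_structure A (\<pi> i) (transition_tensor A \<omega> \<pi> k) \<and>
         OmegaN_structure A (\<omega> i) (transition_tensor A \<omega> \<pi> k)"
proof -
  note A = assms(1) and vb = lie_algebroid_vb[OF assms(1)]
  note S = vector_bundleD(2)[OF vb]
  define N where "N = transition_tensor A \<omega> \<pi> k"
  have symp: "symplectic_form A (\<omega> j)" and inv: "inverse_bivector A (\<omega> j) (\<pi> j)" for j
    using assms(2) by (simp_all add: hypersymplectic_def)
  have sq: "N x (N x v) = \<epsilon> k *\<^sub>R v" if "v \<in> fibre A x" for x v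
    using assms(2) that by (simp add: hypersymplectic_def N_def)
  have two: "\<omega> j \<in> two_forms A" and closed: "closed2 A (\<omega> j)" for j
    using symp[of j] by (simp_all add: symplectic_form_def)
  have biv: "\<pi> j \<in> bivectors A" for j
    using inv[of j] by (simp add: inverse_bivector_def)
  have N_eq: "N = (\<lambda>x v. sharp A (\<pi> (k - 1)) x (flat A (\<omega> (k + 1)) x v))"
    by (simp add: N_def fun_eq_iff transition_tensor_def)
  have endo: "N \<in> bundle_endos A"
    unfolding N_eq by (rule sharp_flat_endo[OF vb two biv])
  note Nf = bundle_endoD(2)[OF endo]
  have minus: "\<omega> (k - 1) x (N x v) w = \<omega> (k + 1) x v w"
    if v: "v \<in> fibre A x" and w: "w \<in> fibre A x" for x v w
  proof -
    have "flat A (\<omega> (k - 1)) x (N x v) = flat A (\<omega> (k + 1)) x v"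
      using inv[of "k - 1"] flat_dual[OF two S v] by (simp add: inverse_bivector_def N_eq)
    from fun_cong[OF this, of w] show ?thesis using w by (simp add: flat_def)
  qed
  have scale: "\<omega> j x (c *\<^sub>R v) w = c * \<omega> j x v w" if "v \<in> fibre A x" "w \<in> fibre A x" for j c x v w
    using two_formD(2)[OF two that(2), of j] that(1) by (simp add: lin_on_def)
  \<comment> \<open>This is \<open>minus\<close> at N v, followed by N^2 = \<epsilon>_k on the
    fibre.\<close>
  have plus: "\<omega> (k + 1) x (N x v) w = \<epsilon> k * \<omega> (k - 1) x v w"
    if "v \<in> fibre A x" "w \<in> fibre A x" for x v w
    using minus[OF Nf[OF that(1)] that(2)] that by (simp add: sq scale)
  \<comment> \<open>Both cases are put into one shape: (c, j) is (1, k + 1) for i = k - 1 and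
    (\<epsilon>_k, k - 1) for i = k + 1. In the integers modulo 3 these are the only indices other
    than k.\<close>
  obtain c j where cj: "\<And>x v w. v \<in> fibre A x \<Longrightarrow> w \<in> fibre A x \<Longrightarrow> \<omega> i x (N x v) w = c * \<omega> j x v w"
  proof -
    have "i = k - 1 \<or> i = k + 1"
      using assms(3) exhaust_3[of i] exhaust_3[of k] by auto
    then show ?thesis
      using minus plus that[of 1 "k + 1"] that[of "\<epsilon> k" "k - 1"] by auto
  qed
  interpret symplectic_endo A "\<omega> i" "\<pi> i" N
  proof
    show "\<omega> i x v (N x w) = \<omega> i x (N x v) w" if v: "v \<in> fibre A x" and w: "w \<in> fibre A x" for x v w
      \<comment> \<open>Self-adjointness comes from skew-symmetry on both sides: \<omega>_i(v, Nw) =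
        -\<omega>_i(Nw, v) = -c \<omega>_j(w, v) = c \<omega>_j(v, w) = \<omega>_i(Nv, w).\<close>
      using two_form_skew[OF two S v Nf[OF w], of i] two_form_skew[OF two S v w, of j] cj v w by simp
    show "closed2 A (\<lambda>x v w. \<omega> i x (N x v) w)"
      by (rule closed2_scale[OF A two closed cj])
  qed (fact A symp inv endo)+
  have "closed2 A (\<lambda>x v w. \<omega> i x (N x (N x v)) w)"
    by (rule closed2_scale[OF A two[of i] closed, where c = "\<epsilon> k"]) (simp add: sq scale)
  from PN_and_OmegaN[OF this] show ?thesis
    by (simp add: N_def)
qed

end
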